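(* Let $a,b\in\mathbb{R}$ and $\ell_1,\ell_2\in\mathbb{Z}$ be such that the three unit intervals $(0,1)\times\{0\}$, $(a,a+1)\times\{\ell_1\}$, $(b,b+1)\times\{\ell_2\}$ in $\mathbb{R}\times\mathbb{Z}$ are pairwise non-overlapping, and let $$\widetilde{\Omega}=(0,1)\times\{0\}\ \cup\ (a,a+1)\times\{\ell_1\}\ \cup\ (b,b+1)\times\{\ell_2\}.$$ Then $\widetilde{\Omega}$ is a weak tile of $\mathbb{R}\times\mathbb{Z}$ if and only if exactly one of the following holds: (1) $0=\ell_1=\ell_2$, and $\{0,a,b\}$ tiles $\mathbb{Z}$; (2) exactly two of $0,\ell_1,\ell_2$ are equal, and one of the following holds: (i) $0\ne\ell_1=\ell_2$ and $a-b\in\mathbb{Z}\setminus\{0\}$; (ii) $\ell_1=0\ne\ell_2$ and $a\in\mathbb{Z}\setminus\{0\}$; (iii) $\ell_2=0\ne\ell_1$ and $b\in\mathbb{Z}\setminus\{0\}$; (3) $0,\ell_1,\ell_2$ are pairwise distinct, and one of the following holds: (i) $\{0,\ell_1,\ell_2\}$ tiles $\mathbb{Z}$; (ii) $\{0,\ell_1,\ell_2\}$ does not tile $\mathbb{Z}$, and there exist $\xi\in\mathbb{R}$ and $M,N\in\mathbb{Z}$ such that $a=M+\ell_1\xi$, $b=N+\ell_2\xi$, where $(M,\ell_1)$ and $(N,\ell_2)$ are $\mathbb{Q}$-linearly independent. Moreover, in each of these cases, $\widetilde{\Omega}$ is both a tile and a spectral set of $\mathbb{R}\times\mathbb{Z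}$.
   Context: $\mathbb{R}\times\mathbb{Z}$ carries the Haar measure given by the product of Lebesgue and counting measure; "a.e." and "non-overlapping" (intersection of measure zero) refer to it. A finite set $F$ tiles $\mathbb{Z}$ if $F\subset\mathbb{Z}$ and there is $T\subset\mathbb{Z}$ such that every integer is uniquely of the form $f+t$ with $f\in F$, $t\in T$. For a bounded measurable $E\subset\mathbb{R}\times\mathbb{Z}$ of positive finite measure: $E$ is a tile if there is a countable $T\subset\mathbb{R}\times\mathbb{Z}$ with $\sum_{t\in T}\mathbf{1}_E(\cdot-t)=1$ a.e.; $E$ is a weak tile if there is a non-negative, locally finite Borel measure $\mu$ on $\mathbb{R}\times\mathbb{Z}$ with $\mathbf{1}_E*\mu=1$ a.e. and $\mu(\{(0,0)\})=1$; $E$ is spectral if there is a countable $\Sigma\subset\mathbb{R}\times\mathbb{T}$, $\mathbb{T}=\mathbb{R}/\mathbb{Z}$, such that the characters $(x,j)\mapsto e^{2\pi i(\lambda x+\eta j)}$, $(\lambda,\eta)\in\Sigma$, form an orthogonal basis of $L^2(E)$. *)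

theory Defs
  imports "HOL-Analysis.Analysis"
begin

abbreviation haar :: "(real \<times> int) measure" where
  "haar \<equiv> lborel \<Otimes>\<^sub>M count_space UNIV"

instance int :: second_countable_topology
proof
  show "\<exists>B :: int set set. countable B \<and> open = generate_topology B"
    by (intro exI[of _ "range lessThan \<union> range greaterThan"]) (auto simp: open_int_def)
qed

lemma sets_haar: "sets haar = sets borel"
proof -
  have "sets haar = sets (borel \<Otimes>\<^sub>M (borel :: int measure))"
    by (intro sets_pair_measure_cong) (auto simp: sets_borel_eq_count_space)
  then show ?thesis
    by (simp only: borel_prod)
qed

(* The library has no metric on the integers, so boundedness is taken in the plane. *)
definition admissible :: "(real \<times> int) set \<Rightarrow> bool" where
  "admissible E \<longleftrightarrow> bounded ((\<lambda>(x, j). (x, real_of_int j)) ` E) \<and>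
     E \<in> sets haar \<and> 0 < emeasure haar E \<and> emeasure haar E < \<infinity>"

definition non_overlapping :: "(real \<times> int) set \<Rightarrow> (real \<times> int) set \<Rightarrow> bool" where
  "non_overlapping A B \<longleftrightarrow> A \<inter> B \<in> null_sets haar"

definition is_tile :: "(real \<times> int) set \<Rightarrow> bool" where
  "is_tile E \<longleftrightarrow> admissible E \<and>
     (\<exists>T. countable T \<and>
          (AE x in haar. ((\<lambda>t. indicator E (x - t) :: real) has_sum 1) T))"

definition locally_finite :: "'a::topological_space measure \<Rightarrow> bool" where
  "locally_finite \<mu> \<longleftrightarrow> (\<forall>x. \<exists>U. open U \<and> x \<in> U \<and> emeasure \<mu> U < \<infinity>)"

definition is_weak_tile :: "(real \<times> int) set \<Rightarrow> bool" where
  "is_weak_tile E \<longleftrightarrow> admissible E \<and>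
     (\<exists>\<mu>. sets \<mu> = sets borel \<and> locally_finite \<mu> \<and>
          (AE x in haar. (\<integral>\<^sup>+ y. indicator E (x - y) \<partial>\<mu>) = 1) \<and>
          emeasure \<mu> {(0, 0)} = 1)"

quotient_type circle = real / "\<lambda>x y :: real. x - y \<in> \<int>"
proof (rule equivpI)
  show "reflp (\<lambda>x y :: real. x - y \<in> \<int>)"
    by (simp add: reflp_def)
  show "symp (\<lambda>x y :: real. x - y \<in> \<int>)"
    by (auto simp: symp_def) (metis Ints_minus minus_diff_eq)
  show "transp (\<lambda>x y :: real. x - y \<in> \<int>)"
    by (auto simp: transp_def) (metis Ints_add diff_add_cancel add_diff_eq)
qed

lift_definition character :: "real \<Rightarrow> circle \<Rightarrow> real \<times> int \<Rightarrow> complex" is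
  "\<lambda>r \<eta> (x, j). cis (2 * pi * (r * x + \<eta> * of_int j))"
proof -
  fix r \<eta> \<eta>' :: real
  assume "\<eta> - \<eta>' \<in> \<int>"
  then obtain k :: int where k: "\<eta> = \<eta>' + of_int k"
    by (metis Ints_cases add.commute diff_add_cancel)
  have "cis (2 * pi * (r * x + \<eta> * of_int j)) = cis (2 * pi * (r * x + \<eta>' * of_int j))"
    for x :: real and j :: int
  proof -
    have "2 * pi * (r * x + \<eta> * of_int j)
        = 2 * pi * (r * x + \<eta>' * of_int j) + 2 * pi * of_int (k * j)"
      by (simp add: k algebra_simps)
    moreover have "cis (2 * pi * of_int (k * j)) = 1"
      by (intro cis_multiple_2pi) auto
    ultimately show ?thesis
      by (metis cis_mult mult.right_neutral)
  qed
  then show "(\<lambda>(x, j). cis (2 * pi * (r * x + \<eta> * of_int j)))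
           = (\<lambda>(x, j). cis (2 * pi * (r * x + \<eta>' * of_int j)))"
    by auto
qed

definition L2 :: "'a measure \<Rightarrow> ('a \<Rightarrow> complex) set" where
  "L2 M = {f \<in> borel_measurable M. integrable M (\<lambda>x. (cmod (f x))\<^sup>2)}"

definition orthogonal_basis_L2 :: "'a measure \<Rightarrow> 'i set \<Rightarrow> ('i \<Rightarrow> 'a \<Rightarrow> complex) \<Rightarrow> bool" where
  "orthogonal_basis_L2 M I e \<longleftrightarrow>
     (\<forall>s\<in>I. e s \<in> L2 M \<and> \<not> (AE x in M. e s x = 0)) \<and>
     (\<forall>s\<in>I. \<forall>t\<in>I. s \<noteq> t \<longrightarrow> (\<integral>x. e s x * cnj (e t x) \<partial>M) = 0) \<and>
     (\<forall>f\<in>L2 M. \<forall>\<epsilon>>0. \<exists>S c. finite S \<and> S \<subseteq> I \<and>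
        sqrt (\<integral>x. (cmod (f x - (\<Sum>s\<in>S. c s * e s x)))\<^sup>2 \<partial>M) < \<epsilon>)"

definition is_spectral :: "(real \<times> int) set \<Rightarrow> bool" where
  "is_spectral E \<longleftrightarrow> admissible E \<and>
     (\<exists>\<Sigma> :: (real \<times> circle) set. countable \<Sigma> \<and>
        orthogonal_basis_L2 (restrict_space haar E) \<Sigma> (\<lambda>(r, \<eta>). character r \<eta>))"

(* Stated for sets of reals, so that being contained in the integers is a condition on F. *)
definition tiles_Ints :: "real set \<Rightarrow> bool" where
  "tiles_Ints F \<longleftrightarrow> finite F \<and> F \<subseteq> \<int> \<and>
     (\<exists>T\<subseteq>\<int>. \<forall>n\<in>\<int>. \<exists>!(f, t). f \<in> F \<and> t \<in> T \<and> n = f + t)"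

definition unit_interval :: "real \<Rightarrow> int \<Rightarrow> (real \<times> int) set" where
  "unit_interval c l = {c<..<c + 1} \<times> {l}"

definition Omega :: "real \<Rightarrow> int \<Rightarrow> real \<Rightarrow> int \<Rightarrow> (real \<times> int) set" where
  "Omega a l1 b l2 = unit_interval 0 0 \<union> unit_interval a l1 \<union> unit_interval b l2"

definition Q_independent :: "int \<times> int \<Rightarrow> int \<times> int \<Rightarrow> bool" where
  "Q_independent v w \<longleftrightarrow>
     (\<forall>p q :: rat. p * of_int (fst v) + q * of_int (fst w) = 0 \<and>
                   p * of_int (snd v) + q * of_int (snd w) = 0 \<longrightarrow> p = 0 \<and> q = 0)"

definition same_level :: "real \<Rightarrow> int \<Rightarrow> real \<Rightarrow> int \<Rightarrow> bool" where
  "same_level a l1 b l2 \<longleftrightarrow> 0 = l1 \<and> l1 = l2 \<and> tiles_Ints {0, a, b}"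

definition two_levels :: "real \<Rightarrow> int \<Rightarrow> real \<Rightarrow> int \<Rightarrow> bool" where
  "two_levels a l1 b l2 \<longleftrightarrow> card {0, l1, l2} = 2 \<and>
     ((0 \<noteq> l1 \<and> l1 = l2 \<and> a - b \<in> \<int> - {0}) \<or>
      (l1 = 0 \<and> 0 \<noteq> l2 \<and> a \<in> \<int> - {0}) \<or>
      (l2 = 0 \<and> 0 \<noteq> l1 \<and> b \<in> \<int> - {0}))"

definition three_levels :: "real \<Rightarrow> int \<Rightarrow> real \<Rightarrow> int \<Rightarrow> bool" where
  "three_levels a l1 b l2 \<longleftrightarrow> 0 \<noteq> l1 \<and> 0 \<noteq> l2 \<and> l1 \<noteq> l2 \<and>
     (tiles_Ints {0, of_int l1, of_int l2} \<or>
      (\<not> tiles_Ints {0, of_int l1, of_int l2} \<and>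
       (\<exists>(\<xi> :: real) (M :: int) (N :: int).
          a = of_int M + of_int l1 * \<xi> \<and> b = of_int N + of_int l2 * \<xi> \<and>
          Q_independent (M, l1) (N, l2))))"

end

theory Submission
  imports Defs
begin

text \<open>
  Write \<open>h(x, j) = \<mu>((x - 1, x) \<times> {j})\<close>. Weak tiling says
  \<open>h(x, j) + h(x - a, j - l1) + h(x - b, j - l2) = 1\<close>. For a bounded function on \<open>\<int> \<times> \<int>\<close>, cubing
  \<open>X + Y = -1\<close>, where \<open>X\<close> and \<open>Y\<close> are the two unit shifts, gives \<open>XY = (1 + X^3 + Y^3) / 3\<close>, so solutions are
  harmonic for a centred random walk and, by Liouville, depend only on the difference of the coordinates modulo 3.
  Hence, with \<open>l1 = g p\<close>, \<open>l2 = g q\<close>, \<open>p\<close> and \<open>q\<close> coprime and \<open>p + q\<close> not divisible by 3, level 0 alone satisfies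
  \<open>h(x) + h(x + D) + h(x - D) = 1\<close> for \<open>D = q a - p b\<close>; the unit atom at the origin then forces
  \<open>D\<close> to be a nonzero integer.

  Conversely, every case provides a character of a suitable lattice that takes the values
  \<open>0, 1/3, 2/3\<close> on the three intervals. The lattice points where its value lies in \<open>[0, 1/3)\<close> tile, and its multiples
  together with the integer frequencies form a spectrum.
\<close>

section \<open>Bounded solutions of a three-term recurrence\<close>

text \<open>One third of Haar measure solves the convolution equation for any three disjoint unit
  intervals, so arithmetic can only come from the unit atom: it fills every window of mass at most 1
  that contains it. The pair \<open>(q, - p)\<close> is used because it generates the kernel of
  \<open>(i, k) \<mapsto> i * l1 + k * l2\<close>: following \<open>(i, k)\<close> moves a window by
  \<open>i * a + k * b\<close> horizontally and by \<open>i * l1 + k * l2\<close> levels, so this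
  pair returns to the same level after the displacement \<open>D\<close>. Its coordinates differ by
  \<open>q + p\<close>, so if 3 does not divide \<open>p + q\<close>, the pairs
  \<open>(0, 0)\<close>, \<open>(q, - p)\<close>, \<open>(- q, p)\<close> represent all three
  classes and their window masses add up to 1. If 3 divides \<open>p + q\<close>, they fall into a
  single class and nothing follows about \<open>D\<close>; that is the case in which the triple of
  levels, if not all are 0, tiles the integers, so no condition on \<open>a\<close>,
  \<open>b\<close> is wanted. For the converse, a nonzero determinant of the reduced offsets and
  levels allows the values 1/3 and 2/3 to be prescribed by solving a linear system; in the tiling
  cases a multiple of one coordinate suffices.\<close>

lemma bounded_harmonic_step_le:
  fixes g :: "'a::ab_group_add \<Rightarrow> real"
  assumes harm: "\<And>p. 3 * g p = g (p + u) + g (p + v) + g (p + w)"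
    and bnd: "\<And>p. \<bar>g p\<bar> \<le> B" and uvw: "u + v + w = 0"
  shows "g (p + u) \<le> g (p + v)"
proof (rule ccontr)
  \<comment> \<open>Shift-invariance makes this difference a bounded solution of the same equation,
    so the supremum argument applies to it.\<close>
  define d where "d q = g (q + u) - g (q + v)" for q
  define M where "M = (SUP q. d q)"
  assume "\<not> g (p + u) \<le> g (p + v)"
  then have "d p > 0" by (simp add: d_def)
  have d_bnd: "d q \<le> 2 * B" for q
    using bnd[of "q + u"] bnd[of "q + v"] by (simp add: d_def abs_le_iff)
  then have bdd: "bdd_above (range d)" by (auto simp: bdd_above_def)
  then have dM: "d q \<le> M" for q unfolding M_def by (rule cSUP_upper2[where x = q]) auto
  then have "M > 0" using \<open>d p > 0\<close> by (meson less_le_trans)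
  have d_harm: "3 * d q = d (q + u) + d (q + v) + d (q + w)" for q
    using harm[of "q + u"] harm[of "q + v"] by (simp add: d_def algebra_simps)
  \<comment> \<open>In \<open>3 * d q\<close>, the two other summands are at most \<open>M\<close>,
    so the third is at least \<open>3 * (M - e) - 2 * M\<close>.\<close>
  have step: "M - 3 * e \<le> d (q + s)" if "M - e \<le> d q" "s \<in> {u, v, w}" for q s e
    using that d_harm[of q] dM[of "q + u"] dM[of "q + v"] dM[of "q + w"] by auto
  obtain m :: nat where m: "real m * (M / 2) > 2 * B"
    using \<open>M > 0\<close> by (metis half_gt_zero reals_Archimedean3)
  \<comment> \<open>Each of \<open>m\<close> moves consists of three steps and multiplies the defect
    by 27; this \<open>e\<close> keeps the defect at most \<open>M / 2\<close> throughout, and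
    \<open>m\<close> such moves accumulate more than the oscillation \<open>2 * B\<close> of
    \<open>g\<close>.\<close>
  define e where "e = M / 2 / 27 ^ m"
  have "e > 0" using \<open>M > 0\<close> by (simp add: e_def)
  then obtain q where q: "M - e < d q"
    using less_cSUP_iff[of UNIV d "M - e"] bdd unfolding M_def by auto
  (* Near the supremum of d, every step loses at most a factor 3; u - v is a sum of three steps,
     so d stays near its supremum along r, and the telescoping sum contradicts boundedness. *)
  define r where "r k = ((\<lambda>x. x + (u - v)) ^^ k) q" for k
  have r_Suc: "r (Suc k) = r k + u + u + w" for k
  proof -
    have "r (Suc k) = r k + u - v + (u + v + w)" by (simp add: r_def uvw)
    then show ?thesis by simp
  qed
  have near: "M - 27 ^ k * e \<le> d (r k)" for k
  proof (induction k)
    case 0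
    then show ?case using q by (simp add: r_def)
  next
    case (Suc k)
    have "M - 3 * (3 * (3 * (27 ^ k * e))) \<le> d (r k + u + u + w)"
      by (intro step Suc) auto
    then show ?case by (simp add: r_Suc)
  qed
  have "M / 2 \<le> d (r k)" if "k < m" for k
  proof -
    have "27 ^ k * e \<le> 27 ^ m * e"
      using that \<open>e > 0\<close> by (intro mult_right_mono power_increasing) auto
    also have "\<dots> = M / 2" by (simp add: e_def)
    finally show ?thesis using near[of k] by simp
  qed
  then have "real m * (M / 2) \<le> (\<Sum>k<m. d (r k))"
    using sum_bounded_below[of "{..<m}" "M / 2" "\<lambda>k. d (r k)"] by simp
  also have "\<dots> = (\<Sum>k<m. g (r (Suc k) + v) - g (r k + v))"
    by (intro sum.cong) (simp_all add: d_def r_def)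
  also have "\<dots> = g (r m + v) - g (r 0 + v)"
    by (rule sum_lessThan_telescope)
  also have "\<dots> \<le> 2 * B"
    using bnd[of "r m + v"] bnd[of "r 0 + v"] by (simp add: abs_le_iff)
  finally show False using m by simp
qed

text \<open>The hypotheses are symmetric in the three steps, so the preceding inequality runs around
  a cycle and the three neighbours take one value, which is then their average
  \<open>g p\<close>.\<close>

lemma bounded_harmonic_periodic:
  fixes g :: "'a::ab_group_add \<Rightarrow> real"
  assumes harm: "\<And>p. 3 * g p = g (p + u) + g (p + v) + g (p + w)"
    and bnd: "\<And>p. \<bar>g p\<bar> \<le> B" and uvw: "u + v + w = 0"
  shows "g (p + u) = g p" "g (p + v) = g p"
proof -
  note le = bounded_harmonic_step_le[OF _ bnd]
  have "g (p + u) \<le> g (p + v)" "g (p + v) \<le> g (p + w)" "g (p + w) \<le> g (p + u)"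
    using harm uvw by (auto intro!: le simp: algebra_simps)
  then show "g (p + u) = g p" "g (p + v) = g p" using harm[of p] by auto
qed

lemma int_multiple_periodic:
  fixes f :: "int \<Rightarrow> 'b"
  assumes "\<And>i. f (i + c) = f i"
  shows "f (i + c * n) = f i"
proof (induction n rule: int_induct[where k = 0])
  case (step1 n)
  then show ?case using assms[of "i + c * n"] by (simp add: algebra_simps)
next
  case (step2 n)
  then show ?case using assms[of "i + c * (n - 1)"] by (simp add: algebra_simps)
qed simp

text \<open>By periodicity \<open>F i k\<close> depends only on \<open>i - k\<close> modulo 3, and
  the recurrence at the origin says that the three class values add up to 1. When 3 does not divide
  \<open>i - k\<close>, the pairs \<open>(i, k)\<close> and \<open>(- i, - k)\<close> represent the
  two nonzero classes.\<close>

lemma bounded_three_term_sum: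
  fixes F :: "int \<Rightarrow> int \<Rightarrow> real"
  assumes rec: "\<And>i k. F i k + F (i - 1) k + F i (k - 1) = 1"
    and bnd: "\<And>i k. \<bar>F i k\<bar> \<le> B" and "\<not> 3 dvd i - k"
  shows "F 0 0 + F i k + F (- i) (- k) = 1"
proof -
  define g where "g p = F (fst p) (snd p)" for p
  \<comment> \<open>With \<open>X\<close>, \<open>Y\<close> the shifts lowering \<open>i\<close>,
    \<open>k\<close>, the six instances are the six terms of the second factor in \<open>X^3 + Y^3 +
    1 - 3XY = (X + Y + 1)(X^2 + Y^2 + 1 - X - Y - XY)\<close>, shifted by \<open>(1, 1)\<close>.
    That factor vanishes at \<open>X = Y = 1\<close>, so the right-hand sides 1 cancel.\<close>
  have h: "3 * F i k = F (i + 1) (k + 1) + F (i - 2) (k + 1) + F (i + 1) (k - 2)" for i k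
    using rec[of "i + 1" "k + 1"] rec[of i "k + 1"] rec[of "i + 1" k]
      rec[of "i - 1" "k + 1"] rec[of i k] rec[of "i + 1" "k - 1"] by simp
  have "3 * g p = g (p + (1, 1)) + g (p + (-2, 1)) + g (p + (1, -2))" for p
    using h[of "fst p" "snd p"] by (simp add: g_def)
  note per = bounded_harmonic_periodic[of g, OF this, of B, unfolded g_def]
  have p1: "F (i + 1) (k + 1) = F i k" for i k using per(1)[of "(i, k)"] bnd by (simp add: zero_prod_def)
  have p2: "F (i - 2) (k + 1) = F i k" for i k using per(2)[of "(i, k)"] bnd by (simp add: zero_prod_def)
  have p3: "F (i + 3) k = F i k" for i k
    using p1[of "i + 2" "k - 1"] p2[of "i + 2" "k - 1"] by (simp add: add.assoc)
  have diag: "F (i + n) (k + n) = F i k" for i k n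
  proof -
    have "F (i + (m + 1)) (k + (m + 1)) = F (i + m) (k + m)" for m
      using p1[of "i + m" "k + m"] by (simp add: add.assoc)
    then show ?thesis using int_multiple_periodic[of "\<lambda>n. F (i + n) (k + n)" 1 0 n] by simp
  qed
  have cls: "F i k = F (i - k + 3 * n) 0" for i k n
    using int_multiple_periodic[of "\<lambda>i. F i 0" 3 "i - k" n] p3 diag[of "i - k" k 0] by simp
  have sum: "F 0 0 + F 1 0 + F (- 1) 0 = 1"
    using rec[of 0 0] diag[of 1 "-1" 0] by simp
  define n where "n = (i - k) div 3"
  have "(i - k) mod 3 = 1 \<or> (i - k) mod 3 = 2"
    using \<open>\<not> 3 dvd i - k\<close> by presburger
  then consider "i - k = 3 * n + 1" | "i - k = 3 * n + 2"
    unfolding n_def by (metis mult_div_mod_eq)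
  then show ?thesis
  proof cases
    case 1
    then show ?thesis using cls[of i k "- n"] cls[of "- i" "- k" n] sum
      by (simp add: algebra_simps)
  next
    case 2
    have a: "i - k + 3 * (- n - 1) = - 1" "- i - - k + 3 * (n + 1) = 1"
      using 2 by auto
    show ?thesis using cls[of i k "- n - 1", unfolded a] cls[of "- i" "- k" "n + 1", unfolded a] sum
      by simp
  qed
qed

section \<open>Three-element tiles of the integers\<close>

lemma coprime_3_dvd_sum:
  fixes p q :: int
  assumes "coprime p q" "3 dvd p + q"
  shows "p mod 3 = 1 \<and> q mod 3 = 2 \<or> p mod 3 = 2 \<and> q mod 3 = 1"
proof -
  have "\<not> 3 dvd p"
  proof
    assume "3 dvd p"
    then have "3 dvd q" using assms(2) by (simp add: dvd_add_right_iff)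
    then have "is_unit (3 :: int)" using \<open>3 dvd p\<close> assms(1) coprime_common_divisor by blast
    then show False by simp
  qed
  then show ?thesis using assms(2) by presburger
qed

text \<open>The numbers 0, \<open>p\<close>, \<open>q\<close> form a complete residue system modulo
  3, so they tile with the multiples of 3; it remains to dilate by \<open>g\<close>.\<close>

lemma tiles_Ints_tripleI:
  fixes g p q :: int
  assumes "g \<noteq> 0" "coprime p q" "3 dvd p + q"
  shows "tiles_Ints {0, of_int (g * p), of_int (g * q)}"
proof -
  \<comment> \<open>Translating by \<open>g * m\<close> changes \<open>t div g\<close> by exactly
    \<open>m\<close> and keeps the remainder, so this single condition tiles every residue class
    modulo \<open>g\<close> at once.\<close>
  define T :: "real set" where "T = of_int ` {t. 3 dvd t div g}"
  have uniq: "\<exists>!(f, t). f \<in> {0, real_of_int (g * p), of_int (g * q)} \<and> t \<in> T \<and> of_int n = f + t" for n :: int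
  proof -
    have T_iff: "of_int t \<in> T \<longleftrightarrow> 3 dvd t div g" for t :: int
      by (auto simp: T_def)
    have div: "(n - g * m) div g = n div g - m" for m
      using div_mult_self1[OF assms(1), of n "- m"] by (simp add: mult.commute)
    have mod3: "(3 dvd m \<or> 3 dvd m - p \<or> 3 dvd m - q) \<and> \<not> (3 dvd m \<and> 3 dvd m - p) \<and>
        \<not> (3 dvd m \<and> 3 dvd m - q) \<and> \<not> (3 dvd m - p \<and> 3 dvd m - q)" for m
    proof -
      have "3 dvd m - r \<longleftrightarrow> 3 dvd m - r mod 3" for r
        by (simp add: dvd_eq_mod_eq_0 mod_diff_right_eq)
      from this[of p] this[of q] show ?thesis using coprime_3_dvd_sum[OF assms(2,3)] by presburger
    qed
    have ex: "3 dvd n div g \<or> 3 dvd n div g - p \<or> 3 dvd n div g - q"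
      and un: "\<not> (3 dvd n div g \<and> 3 dvd n div g - p)" "\<not> (3 dvd n div g \<and> 3 dvd n div g - q)"
        "\<not> (3 dvd n div g - p \<and> 3 dvd n div g - q)"
      using mod3[of "n div g"] by blast+
    define P where "P f \<longleftrightarrow> f \<in> {0, g * p, g * q} \<and> 3 dvd (n - f) div g" for f
    have "\<exists>!f. P f"
      using ex un div[of p] div[of q] unfolding P_def by (auto simp del: div_mult_self4)
    then obtain f where f: "P f" "\<And>f'. P f' \<Longrightarrow> f' = f" by blast
    show ?thesis
    proof (rule ex1I[of _ "(real_of_int f, of_int (n - f))"])
      show "case (real_of_int f, of_int (n - f)) of (f, t) \<Rightarrow>
        f \<in> {0, real_of_int (g * p), of_int (g * q)} \<and> t \<in> T \<and> of_int n = f + t"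
        using f(1) T_iff[of "n - f"] by (auto simp: P_def)
      fix z :: "real \<times> real"
      assume z: "case z of (f, t) \<Rightarrow>
        f \<in> {0, real_of_int (g * p), of_int (g * q)} \<and> t \<in> T \<and> of_int n = f + t"
      then obtain f' where f': "fst z = of_int f'" "f' \<in> {0, g * p, g * q}"
        by (cases z) (auto intro: that[of 0] simp del: of_int_mult)
      then have "snd z = of_int (n - f')" using z by (cases z) auto
      then have "P f'" using z f' T_iff[of "n - f'"] by (cases z) (simp add: P_def)
      then show "z = (real_of_int f, of_int (n - f))"
        using f(2) f' \<open>snd z = _\<close> by (cases z) auto
    qed
  qed
  have "T \<subseteq> \<int>" by (auto simp: T_def)
  moreover have "\<exists>!(f, t). f \<in> {0, real_of_int (g * p), of_int (g * q)} \<and> t \<in> T \<and> n = f + t"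
    if n: "n \<in> \<int>" for n
  proof -
    obtain m :: int where "n = of_int m" using n by (auto elim: Ints_cases)
    then show ?thesis using uniq[of m] by simp
  qed
  ultimately show ?thesis
    unfolding tiles_Ints_def by (intro conjI exI[of _ T] ballI) auto
qed

text \<open>The 0-1 function of the tiling complement, pulled back along
  \<open>(i, k) \<mapsto> i * (g * p) + k * (g * q)\<close>, is a bounded solution of the three-term
  recurrence. The pairs \<open>(q, - p)\<close> and \<open>(- q, p)\<close> map to 0, so three equal
  values would add up to 1, although they can be chosen to be 1.\<close>

lemma tiles_Ints_tripleD:
  fixes g p q :: int
  assumes "tiles_Ints {0, of_int (g * p), of_int (g * q)}"
    and ne: "g * p \<noteq> 0" "g * q \<noteq> 0" "g * p \<noteq> g * q"
  shows "3 dvd p + q"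
proof (rule ccontr)
  assume not3: "\<not> 3 dvd p + q"
  have "\<exists>T\<subseteq>\<int>. \<forall>n\<in>\<int>. \<exists>!(f, t). f \<in> {0, real_of_int (g * p), of_int (g * q)} \<and> t \<in> T \<and> n = f + t"
    using assms(1) unfolding tiles_Ints_def by (elim conjE)
  then obtain T where T: "\<forall>n\<in>\<int>. \<exists>!(f, t). f \<in> {0, real_of_int (g * p), of_int (g * q)} \<and> t \<in> T \<and> n = f + t"
    by (elim exE conjE)
  define c :: "int \<Rightarrow> real" where "c n = (if of_int n \<in> T then 1 else 0)" for n
  have c_sum: "c n + c (n - g * p) + c (n - g * q) = 1" for n
  proof -
    define Q where "Q = (\<lambda>(f, t). f \<in> {0, real_of_int (g * p), of_int (g * q)} \<and> t \<in> T \<and> of_int n = f + t)"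
    have "\<exists>!z. Q z" using bspec[OF T Ints_of_int[of n]] unfolding Q_def .
    then obtain z where "Q z" and Q': "\<And>z'. Q z' \<Longrightarrow> z' = z" by (elim ex1E) blast
    then obtain f t where "Q (f, t)" and Q: "\<And>f' t'. Q (f', t') \<Longrightarrow> f' = f"
      by (metis prod.inject surj_pair)
    then have ft: "f \<in> {0, real_of_int (g * p), of_int (g * q)}" "t \<in> T" "of_int n = f + t"
      by (simp_all add: Q_def)
    have un: "f' = f" if "f' \<in> {0, real_of_int (g * p), of_int (g * q)}" "t' \<in> T" "of_int n = f' + t'" for f' t'
      using Q[of f' t'] that by (simp add: Q_def)
    have c_eq: "c (n - m) = (if of_int m = f then 1 else 0)" if m: "m \<in> {0, g * p, g * q}" for m
    proof -
      have m': "real_of_int m \<in> {0, of_int (g * p), of_int (g * q)}"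
        using m by (auto simp del: of_int_mult)
      have "of_int (n - m) \<in> T \<longleftrightarrow> of_int m = f"
      proof
        assume "of_int (n - m) \<in> T"
        then show "of_int m = f" by (intro un[OF m']) auto
      next
        assume "of_int m = f"
        then have "t = of_int (n - m)" using ft(3) by simp
        then show "of_int (n - m) \<in> T" using ft(2) by simp
      qed
      then show ?thesis unfolding c_def by simp
    qed
    have "real_of_int (g * p) \<noteq> 0" "real_of_int (g * q) \<noteq> 0" "real_of_int (g * p) \<noteq> of_int (g * q)"
      using ne by (simp_all only: of_int_eq_0_iff of_int_eq_iff not_False_eq_True)
    then show ?thesis
      using ft(1) c_eq[of 0] c_eq[of "g * p"] c_eq[of "g * q"]
      by (elim insertE emptyE) (simp_all del: of_int_mult)
  qed
  \<comment> \<open>Starting the lattice at a point of the complement gives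
    \<open>F 0 0 = 1\<close>, hence the contradiction 3 = 1.\<close>
  obtain t where t: "c t = 1"
    using c_sum[of 0] by (metis add_0 c_def zero_neq_one)
  define F where "F i k = c (t + i * (g * p) + k * (g * q))" for i k
  have "F 0 0 + F q (- p) + F (- q) (- (- p)) = 1"
  proof (rule bounded_three_term_sum)
    show "F i k + F (i - 1) k + F i (k - 1) = 1" for i k
      using c_sum[of "t + i * (g * p) + k * (g * q)"] by (simp add: F_def algebra_simps)
    show "\<bar>F i k\<bar> \<le> 1" for i k by (simp add: F_def c_def)
    show "\<not> 3 dvd q - - p" using not3 by (simp add: add.commute)
  qed
  then show False using t by (simp add: F_def algebra_simps)
qed

section \<open>Unit windows and atoms\<close>

text \<open>A window identity known almost everywhere can thereby be evaluated with an endpoint as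
  close to a prescribed real as needed.\<close>

lemma AE_lborel_Ioo_ex:
  assumes "AE x in lborel. P x" "s < (t :: real)"
  obtains x where "s < x" "x < t" "P x"
proof -
  obtain N where N: "{x \<in> space lborel. \<not> P x} \<subseteq> N" "emeasure lborel N = 0" "N \<in> sets lborel"
    using AE_E[OF assms(1)] by blast
  have "\<not> {s<..<t} \<subseteq> N"
  proof
    assume "{s<..<t} \<subseteq> N"
    then have "emeasure lborel {s<..<t} \<le> emeasure lborel N" using N(3) by (intro emeasure_mono)
    then show False using N(2) \<open>s < t\<close> by simp
  qed
  then obtain x where x: "x \<in> {s<..<t}" "x \<notin> N" by blast
  then have "P x" using N(1) by auto
  then show ?thesis using x(1) by (intro that[of x]) auto
qed

text \<open>A window ending just below \<open>p + 1\<close> contains \<open>p\<close>, and the atom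
  exhausts its mass, so the open interval from \<open>p\<close> to \<open>p + 1\<close> is null. A
  window ending just above \<open>p + 1\<close> misses \<open>p\<close>, so its whole mass lies in a
  short interval starting at \<open>p + 1\<close>; these intervals shrink to the point.\<close>

lemma unit_windows_atom_step:
  fixes \<nu> :: "real measure"
  assumes sets: "sets \<nu> = sets borel"
    and win: "AE x in lborel. emeasure \<nu> {x - 1<..<x} = 1"
    and atom: "emeasure \<nu> {p} \<ge> 1"
  shows "emeasure \<nu> {p + 1} \<ge> 1"
proof -
  have null: "emeasure \<nu> {p<..<p + 1} = 0"
  proof -
    have part: "emeasure \<nu> {p<..<p + 1 - 1 / real (Suc n)} = 0" for n
    proof -
      have "p + 1 - 1 / real (Suc n) < p + 1" by simp
      then obtain y where y: "p + 1 - 1 / real (Suc n) < y" "y < p + 1" "emeasure \<nu> {y - 1<..<y} = 1"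
        using AE_lborel_Ioo_ex[OF win] by blast
      have "p < y" by (rule le_less_trans[OF _ y(1)]) (simp add: field_simps)
      have "emeasure \<nu> {p} + emeasure \<nu> {p<..<y} = emeasure \<nu> ({p} \<union> {p<..<y})"
        by (rule plus_emeasure) (auto simp: sets)
      also have "\<dots> \<le> emeasure \<nu> {y - 1<..<y}"
        using y(2) \<open>p < y\<close> by (intro emeasure_mono) (auto simp: sets)
      finally have "1 + emeasure \<nu> {p<..<y} \<le> 1 + 0"
        using atom y(3) by (metis add.right_neutral add_right_mono order_trans)
      then have "emeasure \<nu> {p<..<y} = 0" by (simp only: ennreal_add_left_cancel_le) auto
      moreover have "emeasure \<nu> {p<..<p + 1 - 1 / real (Suc n)} \<le> emeasure \<nu> {p<..<y}"
        using y(1) by (intro emeasure_mono) (auto simp: sets)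
      ultimately show ?thesis by simp
    qed
    have "{p<..<p + 1} \<subseteq> (\<Union>n. {p<..<p + 1 - 1 / real (Suc n)})"
    proof
      fix x assume x: "x \<in> {p<..<p + 1}"
      then obtain n where "1 / real (Suc n) < p + 1 - x"
        using reals_Archimedean[of "p + 1 - x"] by (auto simp: inverse_eq_divide)
      then show "x \<in> (\<Union>n. {p<..<p + 1 - 1 / real (Suc n)})" using x by (auto intro!: exI[of _ n])
    qed
    moreover have "emeasure \<nu> (\<Union>n. {p<..<p + 1 - 1 / real (Suc n)}) = 0"
      using part by (intro emeasure_UN_eq_0) (auto simp: sets)
    ultimately show ?thesis
      by (metis (no_types, lifting) emeasure_eq_0 sets borel_open open_greaterThanLessThan open_UN sets_eq_imp_space_eq)
  qed
  \<comment> \<open>Continuity from above needs finite measure. With \<open>Suc (Suc n)\<close> the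
    lengths are at most 1/2, which leaves room for a window of mass 1 around each
    \<open>A n\<close>.\<close>
  define A where "A n = {p + 1..<p + 1 + 1 / real (Suc (Suc n))}" for n
  have A_ge: "emeasure \<nu> (A n) \<ge> 1" for n
  proof -
    have "p + 1 < p + 1 + 1 / real (Suc (Suc n))" by simp
    then obtain y where y: "p + 1 < y" "y < p + 1 + 1 / real (Suc (Suc n))" "emeasure \<nu> {y - 1<..<y} = 1"
      using AE_lborel_Ioo_ex[OF win] by blast
    have "emeasure \<nu> {y - 1<..<y} \<le> emeasure \<nu> ({p<..<p + 1} \<union> A n)"
      using y by (intro emeasure_mono) (auto simp: sets A_def)
    also have "\<dots> \<le> emeasure \<nu> {p<..<p + 1} + emeasure \<nu> (A n)"
      by (intro emeasure_subadditive) (auto simp: sets A_def)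
    finally show ?thesis using null y(3) by simp
  qed
  have "emeasure \<nu> (A n) \<noteq> \<infinity>" for n
  proof -
    obtain y where y: "p + 3 / 2 < y" "y < p + 2" "emeasure \<nu> {y - 1<..<y} = 1"
      using AE_lborel_Ioo_ex[OF win, of "p + 3/2" "p + 2"] by auto
    have "1 / real (Suc (Suc n)) \<le> 1 / 2" by (simp add: field_simps)
    then have "p + 1 + 1 / real (Suc (Suc n)) < y" using y(1) by linarith
    then have "emeasure \<nu> (A n) \<le> emeasure \<nu> {y - 1<..<y}"
      using y(2) by (intro emeasure_mono) (auto simp: sets A_def)
    then show ?thesis using y(3) by (auto simp: top_unique)
  qed
  moreover have "range A \<subseteq> sets \<nu>" by (auto simp: A_def sets)
  moreover have "decseq A"
    by (intro decseq_SucI) (auto simp: A_def elim!: less_le_trans intro!: divide_left_mono)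
  ultimately have "(INF n. emeasure \<nu> (A n)) = emeasure \<nu> (\<Inter>n. A n)"
    by (intro INF_emeasure_decseq)
  moreover have "(\<Inter>n. A n) = {p + 1}"
  proof (intro equalityI subsetI)
    fix x assume x: "x \<in> (\<Inter>n. A n)"
    show "x \<in> {p + 1}"
    proof (rule ccontr)
      assume "x \<notin> {p + 1}"
      then have "0 < x - (p + 1)" using x by (auto simp: A_def)
      then obtain n where n: "1 / real (Suc n) < x - (p + 1)"
        using reals_Archimedean[of "x - (p + 1)"] by (auto simp: inverse_eq_divide)
      have "1 / real (Suc (Suc n)) \<le> 1 / real (Suc n)" by (simp add: field_simps)
      moreover have "x < p + 1 + 1 / real (Suc (Suc n))" using x by (auto simp: A_def)
      ultimately show False using n by simp
    qed
  qed (auto simp: A_def)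
  ultimately show ?thesis using A_ge by (metis INF_greatest)
qed

text \<open>The atom at the smaller point propagates in unit steps up to the other one. At a
  non-integer distance the last copy and the other atom would lie less than 1 apart, hence in a
  common window, whose mass would be at least 2.\<close>

lemma unit_windows_atoms_Ints:
  fixes \<nu> :: "real measure"
  assumes sets: "sets \<nu> = sets borel"
    and win: "AE x in lborel. emeasure \<nu> {x - 1<..<x} = 1"
    and atoms: "emeasure \<nu> {p} \<ge> 1" "emeasure \<nu> {q} \<ge> 1"
  shows "q - p \<in> \<int>"
  using atoms
proof (induction p q rule: linorder_wlog)
  case (sym p q)
  then show ?case by (metis Ints_minus minus_diff_eq)
next
  case (le p q)
  have atom: "emeasure \<nu> {p + real n} \<ge> 1" for n
  proof (induction n)
    case (Suc n)
    then show ?case using unit_windows_atom_step[OF sets win, of "p + real n"] by (simp add: ac_simps)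
  qed (use le in simp)
  define n where "n = nat \<lfloor>q - p\<rfloor>"
  have n: "real n \<le> q - p" "q - p < real n + 1" using le(1) by (simp_all add: n_def)
  show ?case
  proof (rule ccontr)
    assume "q - p \<notin> \<int>"
    then have "q - p \<noteq> real n" by (metis Ints_of_nat)
    then have "q < p + real n + 1" "p + real n < q" using n by simp_all
    then obtain y where y: "q < y" "y < p + real n + 1" "emeasure \<nu> {y - 1<..<y} = 1"
      using AE_lborel_Ioo_ex[OF win] by blast
    have "emeasure \<nu> {p + real n} + emeasure \<nu> {q} = emeasure \<nu> ({p + real n} \<union> {q})"
      using \<open>p + real n < q\<close> by (intro plus_emeasure) (auto simp: sets)
    also have "\<dots> \<le> emeasure \<nu> {y - 1<..<y}"
      using y \<open>p + real n < q\<close> by (intro emeasure_mono) (auto simp: sets)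
    also have "\<dots> = 1" by fact
    finally have "1 + 1 \<le> (1 :: ennreal)"
      using add_mono[OF atom[of n] le(3)] by (meson order_trans)
    then show False by (simp flip: ennreal_1 ennreal_plus add: ennreal_le_iff del: ennreal_1)
  qed
qed

lemma add_measures:
  assumes "sets N = sets M"
  obtains L where "sets L = sets M" "\<And>A. A \<in> sets M \<Longrightarrow> emeasure L A = emeasure M A + emeasure N A"
proof -
  define L where "L = measure_of (space M) (sets M) (\<lambda>A. emeasure M A + emeasure N A)"
  have sets_L: "sets L = sets M" by (simp add: L_def sets.space_closed sets.sigma_sets_eq)
  moreover have "emeasure L A = emeasure M A + emeasure N A" if "A \<in> sets M" for A
  proof (rule emeasure_measure_of[OF L_def])
    show "countably_additive (sets L) (\<lambda>A. emeasure M A + emeasure N A)"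
      unfolding sets_L
      by (intro countably_additiveI) (simp add: suminf_add[symmetric] suminf_emeasure assms subset_eq image_subset_iff)
    show "positive (sets L) (\<lambda>A. emeasure M A + emeasure N A)" by (simp add: positive_def)
  qed (use that sets_L sets.space_closed in auto)
  ultimately show thesis by (rule that)
qed

text \<open>The sum of \<open>\<mu>\<close> and its translates by \<open>- c\<close> and
  \<open>- d\<close> has mass 1 in almost every unit window. The atom at 0 survives in it together
  with a copy at \<open>- c\<close>, so their distance \<open>c\<close> is an integer.\<close>

lemma three_windows_Ints:
  fixes \<mu> :: "real measure"
  assumes sets: "sets \<mu> = sets borel"
    and win: "AE x in lborel. emeasure \<mu> {x - 1<..<x} + emeasure \<mu> {x + c - 1<..<x + c}
                + emeasure \<mu> {x + d - 1<..<x + d} = 1"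
    and atom: "emeasure \<mu> {0} \<ge> 1"
  shows "c \<in> \<int>"
proof -
  define T where "T s = distr \<mu> borel (\<lambda>t. t - s)" for s
  have T: "emeasure (T s) A = emeasure \<mu> ((\<lambda>t. t - s) -` A)" if "A \<in> sets borel" for s A
    using that sets_eq_imp_space_eq[OF sets]
    by (simp add: T_def emeasure_distr measurable_cong_sets[OF sets refl])
  obtain L where L: "sets L = sets \<mu>" "\<And>A. A \<in> sets \<mu> \<Longrightarrow> emeasure L A = emeasure \<mu> A + emeasure (T c) A"
    using add_measures[of "T c" \<mu>] by (auto simp: T_def sets)
  obtain N where N: "sets N = sets L" "\<And>A. A \<in> sets L \<Longrightarrow> emeasure N A = emeasure L A + emeasure (T d) A"
    using add_measures[of "T d" L] L(1) by (auto simp: T_def sets)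
  have N_eq: "emeasure N A = emeasure \<mu> A + emeasure \<mu> ((\<lambda>t. t - c) -` A) + emeasure \<mu> ((\<lambda>t. t - d) -` A)"
    if "A \<in> sets borel" for A
    using that L N sets T by simp
  have "(\<lambda>t. t - s) -` {x - 1<..<x} = {x + s - 1<..<x + s}" for s x :: real by auto
  then have "AE x in lborel. emeasure N {x - 1<..<x} = 1"
    using win by (simp add: N_eq)
  moreover have "(\<lambda>t. t - c) -` {- c} = {0}" by auto
  then have "emeasure N {- c} \<ge> 1"
    using atom by (simp add: N_eq) (metis add.commute add_increasing2 zero_le)
  moreover have "emeasure N {0} \<ge> 1"
    using atom by (simp add: N_eq add_increasing2)
  ultimately have "0 - - c \<in> \<int>"
    using sets L(1) N(1) by (intro unit_windows_atoms_Ints[of N]) auto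
  then show ?thesis by simp
qed

section \<open>Window masses of measures on the product of the line and the integers\<close>

interpretation haar: pair_sigma_finite lborel "count_space (UNIV :: int set)"
  by (intro pair_sigma_finite.intro lborel.sigma_finite_measure_axioms
      sigma_finite_measure_count_space_countable) simp

lemma unit_interval_sets: "unit_interval c l \<in> sets haar"
  unfolding unit_interval_def by (intro pair_measureI) auto

text \<open>Two open unit intervals on one level meet in an open interval, which is either empty or
  of positive length.\<close>

lemma non_overlapping_unit_intervalD:
  assumes "non_overlapping (unit_interval c l) (unit_interval d m)"
  shows "unit_interval c l \<inter> unit_interval d m = {}"
proof (rule ccontr)
  assume ne: "unit_interval c l \<inter> unit_interval d m \<noteq> {}"
  then have "m = l" and lt: "max c d < min c d + 1" by (auto simp: unit_interval_def)
  then have "unit_interval c l \<inter> unit_interval d m = {max c d<..<min c d + 1} \<times> {l}"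
    by (auto simp: unit_interval_def)
  moreover have "emeasure haar ({max c d<..<min c d + 1} \<times> {l}) = ennreal (min c d + 1 - max c d)"
    using lt by (subst haar.M2.emeasure_pair_measure_Times) auto
  ultimately show False
    using assms lt by (auto simp: non_overlapping_def null_sets_def)
qed

lemma AE_haar_imp_levels:
  assumes "AE z in haar. P z"
  shows "AE x in lborel. \<forall>j. P (x, j)"
  using haar.AE_pair[OF assms] by (simp add: AE_count_space)

lemma AE_lborel_translate:
  assumes "AE x in lborel. P x"
  shows "AE x in lborel. P (x + t :: real)"
proof -
  obtain N where N: "{x \<in> space lborel. \<not> P x} \<subseteq> N" "emeasure lborel N = 0" "N \<in> sets lborel"
    using AE_E[OF assms] by blast
  have "AE x in lborel. x \<notin> N" using N by (intro AE_not_in) auto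
  then have "AE x in lborel. t + 1 * x \<notin> N"
    using N(3) by (intro AE_borel_affine[where P = "\<lambda>x. x \<notin> N"]) auto
  then show ?thesis by eventually_elim (use N(1) in \<open>auto simp: add.commute\<close>)
qed

definition window :: "(real \<times> int) measure \<Rightarrow> real \<Rightarrow> int \<Rightarrow> ennreal" where
  "window \<mu> x j = emeasure \<mu> ({x - 1<..<x} \<times> {j})"

lemma window_rect_sets:
  assumes "sets \<mu> = sets borel"
  shows "{s<..<t :: real} \<times> {j :: int} \<in> sets \<mu>"
  unfolding assms by (intro borel_open open_Times open_discrete open_greaterThanLessThan)

lemma Omega_convolution:
  assumes sets: "sets \<mu> = sets borel"
    and disj: "unit_interval 0 0 \<inter> unit_interval a l1 = {}"
      "unit_interval 0 0 \<inter> unit_interval b l2 = {}" "unit_interval a l1 \<inter> unit_interval b l2 = {}"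
  shows "(\<integral>\<^sup>+ y. indicator (Omega a l1 b l2) ((x, j) - y) \<partial>\<mu>)
       = window \<mu> x j + window \<mu> (x - a) (j - l1) + window \<mu> (x - b) (j - l2)"
proof -
  have ind: "indicator (unit_interval c l) ((x, j) - y)
      = (indicator ({x - c - 1<..<x - c} \<times> {j - l}) y :: ennreal)" for c l y
    by (cases y) (auto simp: unit_interval_def indicator_def)
  have "(indicator (Omega a l1 b l2) z :: ennreal) = indicator (unit_interval 0 0) z
      + indicator (unit_interval a l1) z + indicator (unit_interval b l2) z" for z
    using disj by (auto simp: Omega_def indicator_def)
  then show ?thesis
    using window_rect_sets[OF sets]
    by (simp add: ind nn_integral_add window_def)
qed

text \<open>For fixed \<open>x\<close>, window masses along the points
  \<open>(x + i * a + k * b, i * l1 + k * l2)\<close> solve the lattice recurrence;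
  \<open>level\<close> says that the class representatives \<open>(i0, k0)\<close> and
  \<open>(- i0, - k0)\<close> both land on level 0.\<close>

lemma windows_combination:
  fixes a b :: real and l1 l2 i0 k0 :: int
  assumes win: "AE x in lborel. \<forall>j. window \<mu> x j + window \<mu> (x - a) (j - l1) + window \<mu> (x - b) (j - l2) = 1"
    and level: "i0 * l1 + k0 * l2 = 0" and cls: "\<not> 3 dvd i0 - k0"
  defines "D \<equiv> of_int i0 * a + of_int k0 * b"
  shows "AE x in lborel. window \<mu> x 0 + window \<mu> (x + D) 0 + window \<mu> (x - D) 0 = 1"
proof -
  \<comment> \<open>The lattice is countable, so one null set of \<open>x\<close> can be discarded
    for all its points at once.\<close>
  have "AE x in lborel. \<forall>i k :: int. \<forall>j. let y = x + (of_int i * a + of_int k * b) in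
      window \<mu> y j + window \<mu> (y - a) (j - l1) + window \<mu> (y - b) (j - l2) = 1"
    unfolding AE_all_countable Let_def
  proof (intro allI)
    fix i k j
    show "AE x in lborel. window \<mu> (x + (of_int i * a + of_int k * b)) j
        + window \<mu> (x + (of_int i * a + of_int k * b) - a) (j - l1)
        + window \<mu> (x + (of_int i * a + of_int k * b) - b) (j - l2) = 1"
      using AE_lborel_translate[OF win] by eventually_elim blast
  qed
  then show ?thesis
  proof eventually_elim
    fix x
    assume *: "\<forall>i k :: int. \<forall>j. let y = x + (of_int i * a + of_int k * b) in
      window \<mu> y j + window \<mu> (y - a) (j - l1) + window \<mu> (y - b) (j - l2) = 1"
    define W where "W i k = window \<mu> (x + (of_int i * a + of_int k * b)) (i * l1 + k * l2)" for i k
    have W: "W i k + W (i - 1) k + W i (k - 1) = 1" for i k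
      using *[rule_format, of i k "i * l1 + k * l2"]
      by (simp add: W_def Let_def algebra_simps)
    \<comment> \<open>The bound serves twice: it makes the masses finite, so that they become real
      numbers, and it is the boundedness needed for the Liouville argument.\<close>
    then have W_le: "W i k \<le> 1" for i k
      by (metis add_increasing2 order_refl zero_le add.assoc)
    define F where "F i k = enn2real (W i k)" for i k
    have W_F: "W i k = ennreal (F i k)" for i k
      using le_less_trans[OF W_le[of i k] ennreal_one_less_top] by (simp add: F_def)
    have F_nn: "F i k \<ge> 0" for i k by (simp add: F_def)
    have "F 0 0 + F i0 k0 + F (- i0) (- k0) = 1"
    proof (rule bounded_three_term_sum[OF _ _ cls])
      show "F i k + F (i - 1) k + F i (k - 1) = 1" for i k
        using W[of i k] F_nn by (simp add: W_F flip: ennreal_plus)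
      show "\<bar>F i k\<bar> \<le> 1" for i k
        using W_le[of i k] F_nn[of i k] by (simp add: W_F)
    qed
    then have "W 0 0 + W i0 k0 + W (- i0) (- k0) = 1"
      using F_nn by (simp add: W_F flip: ennreal_plus)
    moreover have "- (i0 * l1) - k0 * l2 = 0" using level by simp
    ultimately show "window \<mu> x 0 + window \<mu> (x + D) 0 + window \<mu> (x - D) 0 = 1"
      using level by (simp add: W_def D_def algebra_simps)
  qed
qed

lemma level_measure:
  assumes "sets \<mu> = sets (borel :: (real \<times> int) measure)"
  obtains \<mu>0 :: "real measure" where "sets \<mu>0 = sets borel"
    "\<And>A. A \<in> sets borel \<Longrightarrow> emeasure \<mu>0 A = emeasure \<mu> (A \<times> {j})"
proof -
  define R where "R = restrict_space \<mu> (UNIV \<times> {j})"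
  have meas: "A \<times> {j} \<in> sets \<mu>" if "A \<in> sets (borel :: real measure)" for A
    using that unfolding assms borel_prod[symmetric] by (intro pair_measureI) auto
  have "fst \<in> measurable (borel :: (real \<times> int) measure) (borel :: real measure)"
    by (intro borel_measurable_continuous_onI continuous_on_fst continuous_on_id)
  then have fst: "fst \<in> measurable R borel"
    unfolding R_def measurable_cong_sets[OF assms refl, symmetric] by (rule measurable_restrict_space1)
  define \<mu>0 where "\<mu>0 = distr R borel fst"
  have "emeasure \<mu>0 A = emeasure \<mu> (A \<times> {j})" if A: "A \<in> sets borel" for A
  proof -
    have "fst -` A \<inter> space R = A \<times> {j}"
      using sets_eq_imp_space_eq[OF assms] by (auto simp: R_def space_restrict_space)
    then show ?thesis
      using A fst meas[of A] meas[of UNIV] sets_eq_imp_space_eq[OF assms]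
      by (simp add: \<mu>0_def emeasure_distr R_def) (subst emeasure_restrict_space; auto)
  qed
  then show thesis by (intro that[of \<mu>0]) (auto simp: \<mu>0_def)
qed

lemma windows_at_level_Ints:
  assumes sets: "sets \<mu> = sets borel" and atom: "emeasure \<mu> {(0, 0)} = 1"
    and win: "AE x in lborel. window \<mu> x 0 + window \<mu> (x + c) 0 + window \<mu> (x + d) 0 = 1"
  shows "c \<in> \<int>"
proof -
  obtain \<mu>0 :: "real measure" where \<mu>0: "sets \<mu>0 = sets borel"
    "\<And>A. A \<in> sets borel \<Longrightarrow> emeasure \<mu>0 A = emeasure \<mu> (A \<times> {0})"
    using level_measure[OF sets] by blast
  show ?thesis
    using win atom \<mu>0 by (intro three_windows_Ints[of \<mu>0 c d]) (simp_all add: window_def)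
qed

text \<open>This rules out \<open>D = 0\<close>: the three windows would coincide and have mass 1/3
  each, but a window around the origin has mass at least 1.\<close>

lemma windows_at_origin_not_third:
  assumes sets: "sets \<mu> = sets borel" and atom: "emeasure \<mu> {(0, 0)} = 1"
    and win: "AE x in lborel. window \<mu> x 0 + window \<mu> x 0 + window \<mu> x 0 = 1"
  shows False
proof -
  obtain x where x: "0 < x" "x < 1" "window \<mu> x 0 + window \<mu> x 0 + window \<mu> x 0 = 1"
    using AE_lborel_Ioo_ex[OF win, of 0 1] by auto
  have "emeasure \<mu> {(0, 0)} \<le> window \<mu> x 0"
    unfolding window_def using x by (intro emeasure_mono window_rect_sets[OF sets]) auto
  then have "1 + 1 \<le> window \<mu> x 0 + window \<mu> x 0"
    using atom by (intro add_mono) auto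
  also have "\<dots> \<le> 1" using x(3) by (metis add_increasing2 order_refl zero_le)
  finally show False by (simp flip: ennreal_1 ennreal_plus add: ennreal_le_iff del: ennreal_1)
qed

text \<open>This is the whole necessary condition extracted from the recurrence. It is applied to
  \<open>(q, - p)\<close>; integrality comes from comparing the atom with its translate, and
  nonvanishing from the size of the atom.\<close>

lemma weak_tile_kernel:
  fixes a b :: real and l1 l2 i k :: int
  assumes disj: "unit_interval 0 0 \<inter> unit_interval a l1 = {}"
      "unit_interval 0 0 \<inter> unit_interval b l2 = {}" "unit_interval a l1 \<inter> unit_interval b l2 = {}"
    and tile: "is_weak_tile (Omega a l1 b l2)"
    and level: "i * l1 + k * l2 = 0" and cls: "\<not> 3 dvd i - k"
  shows "of_int i * a + of_int k * b \<in> \<int> - {0}"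
proof -
  define D where "D = of_int i * a + of_int k * b"
  obtain \<mu> where sets: "sets \<mu> = sets borel" and atom: "emeasure \<mu> {(0, 0)} = 1"
    and conv: "AE x in haar. (\<integral>\<^sup>+ y. indicator (Omega a l1 b l2) (x - y) \<partial>\<mu>) = 1"
    using tile unfolding is_weak_tile_def by blast
  have "AE x in lborel. \<forall>j. window \<mu> x j + window \<mu> (x - a) (j - l1) + window \<mu> (x - b) (j - l2) = 1"
    using AE_haar_imp_levels[OF conv] by (simp add: Omega_convolution[OF sets disj])
  from windows_combination[OF this level cls]
  have "AE x in lborel. window \<mu> x 0 + window \<mu> (x + D) 0 + window \<mu> (x + - D) 0 = 1"
    unfolding D_def[symmetric] by simp
  then have "D \<in> \<int>" "D \<noteq> 0"
    using windows_at_level_Ints[OF sets atom, of D "- D"] windows_at_origin_not_third[OF sets atom]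
    by (blast, fastforce)
  then show ?thesis by (simp add: D_def)
qed

text \<open>On one level the tiling equation already has the three-window form, with shifts
  \<open>- a\<close> and \<open>- b\<close>, so the atom argument applies without the lattice
  recurrence.\<close>

lemma weak_tile_same_level_Ints:
  assumes disj: "unit_interval 0 0 \<inter> unit_interval a 0 = {}"
      "unit_interval 0 0 \<inter> unit_interval b 0 = {}" "unit_interval a 0 \<inter> unit_interval b 0 = {}"
    and tile: "is_weak_tile (Omega a 0 b 0)"
  shows "a \<in> \<int>" "b \<in> \<int>"
proof -
  obtain \<mu> where sets: "sets \<mu> = sets borel" and atom: "emeasure \<mu> {(0, 0)} = 1"
    and conv: "AE x in haar. (\<integral>\<^sup>+ y. indicator (Omega a 0 b 0) (x - y) \<partial>\<mu>) = 1"
    using tile unfolding is_weak_tile_def by blast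
  have win: "AE x in lborel. window \<mu> x 0 + window \<mu> (x + - a) 0 + window \<mu> (x + - b) 0 = 1"
    using AE_haar_imp_levels[OF conv] by eventually_elim (simp add: Omega_convolution[OF sets disj])
  then have "AE x in lborel. window \<mu> x 0 + window \<mu> (x + - b) 0 + window \<mu> (x + - a) 0 = 1"
    by (simp add: add_ac)
  then have "- b \<in> \<int>" by (rule windows_at_level_Ints[OF sets atom])
  moreover have "- a \<in> \<int>" using win by (rule windows_at_level_Ints[OF sets atom])
  ultimately show "a \<in> \<int>" "b \<in> \<int>" using Ints_minus by force+
qed

section \<open>Tiling by a character\<close>

lemma emeasure_unit_interval: "emeasure haar (unit_interval c l) = 1"
  unfolding unit_interval_def by (subst haar.M2.emeasure_pair_measure_Times) auto

lemma AE_haar_fst_notin: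
  assumes "countable C"
  shows "AE z in haar. fst z \<notin> C"
proof -
  have C: "C \<in> null_sets lborel" using assms by (rule countable_imp_null_set_lborel)
  have "C \<times> UNIV \<in> null_sets haar"
  proof (intro null_setsI)
    show "emeasure haar (C \<times> UNIV) = 0"
      using C by (subst haar.M2.emeasure_pair_measure_Times) (auto simp: null_sets_def)
    show "C \<times> UNIV \<in> sets haar"
      using C by (intro pair_measureI) auto
  qed
  from AE_not_in[OF this] show ?thesis by eventually_elim auto
qed

text \<open>The translates of the arc from 0 to \<open>1 / N\<close> by multiples of
  \<open>1 / N\<close> tile the circle. This finite tiling is what gets pulled back along the
  character.\<close>

lemma frac_shift_less_iff:
  assumes "i < N"
  shows "frac (y - real i / real N) < 1 / real N \<longleftrightarrow> \<lfloor>real N * frac y\<rfloor> = int i"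
proof -
  have N: "0 < real N" using assms by simp
  have f: "0 \<le> frac y" "frac y < 1" by (simp_all add: frac_lt_1)
  have iN: "0 \<le> real i / real N" "real i / real N + 1 / real N \<le> 1"
    using assms by (auto simp: field_simps)
  have lo: "real i / real N \<le> frac y \<longleftrightarrow> real i \<le> real N * frac y"
    using N by (auto simp: field_simps)
  have up: "frac y - real i / real N < 1 / real N \<longleftrightarrow> real N * frac y < real i + 1"
    using pos_less_divide_eq[OF N, of "frac y" "real i + 1"]
    by (simp add: add_divide_distrib diff_less_eq ac_simps)
  have fl: "\<lfloor>real N * frac y\<rfloor> = int i \<longleftrightarrow> real i \<le> real N * frac y \<and> real N * frac y < real i + 1"
    by (simp add: floor_eq_iff)
  have "y - real i / real N = frac y - real i / real N + of_int \<lfloor>y\<rfloor>" by (simp add: frac_def)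
  then have eq: "frac (y - real i / real N) = frac (frac y - real i / real N)"
    by (metis frac_add_int_right Ints_of_int frac_add_of_int_right)
  show ?thesis
  proof (cases "real i / real N \<le> frac y")
    case True
    then have "0 \<le> frac y - real i / real N \<and> frac y - real i / real N < 1"
      using f iN by linarith
    then have "frac (frac y - real i / real N) = frac y - real i / real N"
      by (rule frac_eq[THEN iffD2])
    then show ?thesis using eq up fl lo True by simp
  next
    case False
    have "0 < 1 / real N" using N by simp
    then have "0 \<le> frac y - real i / real N + 1 \<and> frac y - real i / real N + 1 < 1"
      using f iN False by linarith
    then have "frac (frac y - real i / real N + 1) = frac y - real i / real N + 1"
      by (intro frac_eq[THEN iffD2]) auto
    then have "frac (frac y - real i / real N) = frac y - real i / real N + 1"
      using frac_add_of_int_right[of "frac y - real i / real N" 1] by simp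
    moreover have "\<not> frac y - real i / real N + 1 < 1 / real N" using f(1) iN(2) by linarith
    ultimately show ?thesis using eq fl lo False by simp
  qed
qed

text \<open>
  The character \<open>(x, j) \<mapsto> \<alpha> x + \<beta> j\<close> of the sheared group separates the intervals modulo 1. When
  \<open>\<alpha> = 0\<close> the horizontal offsets \<open>d i\<close> are irrelevant; otherwise they have to be integers.
\<close>

locale interval_character =
  fixes N :: nat and c d :: "nat \<Rightarrow> real" and l :: "nat \<Rightarrow> int" and \<xi> \<alpha> \<beta> :: real
  assumes N_pos: "0 < N"
    and c_eq: "\<And>i. i < N \<Longrightarrow> c i = d i + of_int (l i) * \<xi>"
    and d_Ints: "\<alpha> = 0 \<or> (\<forall>i<N. d i \<in> \<int>)"
    and char_value: "\<And>i. i < N \<Longrightarrow> \<alpha> * d i + \<beta> * of_int (l i) - real i / real N \<in> \<int>"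
begin

definition \<Omega> :: "(real \<times> int) set" where
  "\<Omega> = (\<Union>i<N. unit_interval (c i) (l i))"

lemma admissible_\<Omega>: "admissible \<Omega>"
proof -
  have "bounded ((\<lambda>(x, j). (x, real_of_int j)) ` \<Omega>)"
  proof (rule bounded_subset)
    show "bounded (\<Union>i<N. {c i<..<c i + 1} \<times> {real_of_int (l i)})"
      by (intro bounded_UN finite_lessThan ballI) (auto simp flip: box_real intro!: bounded_Times)
  qed (auto simp: \<Omega>_def unit_interval_def)
  moreover have "\<Omega> \<in> sets haar"
    unfolding \<Omega>_def by (intro sets.finite_UN finite_lessThan unit_interval_sets)
  moreover have "1 \<le> emeasure haar \<Omega>"
    using N_pos \<open>\<Omega> \<in> sets haar\<close> unfolding emeasure_unit_interval[of "c 0" "l 0", symmetric]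
    by (intro emeasure_mono) (auto simp: \<Omega>_def)
  moreover have "emeasure haar \<Omega> \<le> (\<Sum>i<N. emeasure haar (unit_interval (c i) (l i)))"
    unfolding \<Omega>_def using unit_interval_sets by (intro emeasure_subadditive_finite) auto
  then have "emeasure haar \<Omega> \<le> of_nat N" by (simp add: emeasure_unit_interval)
  then have "emeasure haar \<Omega> < \<infinity>" by (simp add: le_less_trans[OF _ of_nat_less_top])
  ultimately show ?thesis
    by (simp add: admissible_def less_le_trans[of 0 "1 :: ennreal"])
qed

definition T :: "(real \<times> int) set" where
  "T = {(of_int n + of_int j * \<xi>, j) | n j. frac (\<alpha> * of_int n + \<beta> * of_int j) < 1 / real N}"

lemma countable_T: "countable T"
proof (rule countable_subset)
  show "T \<subseteq> (\<lambda>(n :: int, j). (of_int n + of_int j * \<xi>, j)) ` UNIV" by (auto simp: T_def)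
qed auto

lemma origin_in_T: "(0, 0) \<in> T"
  using N_pos by (auto simp: T_def intro!: exI[of _ 0])

text \<open>The two alternatives of \<open>d_Ints\<close> meet here: either the factor
  \<open>\<alpha>\<close> kills both sides, or an integer offset passes through the floor.\<close>

lemma floor_translate: "i < N \<Longrightarrow> \<alpha> * of_int \<lfloor>u - d i\<rfloor> = \<alpha> * of_int \<lfloor>u\<rfloor> - \<alpha> * d i"
  using d_Ints by (auto simp: algebra_simps elim!: Ints_cases)

text \<open>Interval \<open>i\<close> can reach \<open>(x, j)\<close> only from the lattice point
  \<open>t i\<close> with column \<open>n i\<close> and level \<open>j - l i\<close>. The character
  takes there, modulo 1, the value \<open>y - i / N\<close> with \<open>y\<close> independent of
  \<open>i\<close>, so \<open>t i\<close> belongs to \<open>T\<close> exactly when \<open>y\<close>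
  lies in arc \<open>i\<close>. The hypothesis excludes endpoints of intervals.\<close>

lemma T_unique:
  assumes x: "\<And>i. i < N \<Longrightarrow> x - of_int j * \<xi> - d i \<notin> \<int>"
  shows "\<exists>t0\<in>T. \<forall>t\<in>T. (x, j) - t \<in> \<Omega> \<longleftrightarrow> t = t0"
proof -
  define u where "u = x - of_int j * \<xi>"
  define n where "n i = \<lfloor>u - d i\<rfloor>" for i
  define i0 where "i0 = nat \<lfloor>real N * frac (\<alpha> * of_int \<lfloor>u\<rfloor> + \<beta> * of_int j)\<rfloor>"
  define t where "t i = (of_int (n i) + of_int (j - l i) * \<xi>, j - l i)" for i
  have "real N * frac (\<alpha> * of_int \<lfloor>u\<rfloor> + \<beta> * of_int j) < real N"
    using N_pos frac_lt_1 by simp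
  then have i0: "i0 < N" "\<lfloor>real N * frac (\<alpha> * of_int \<lfloor>u\<rfloor> + \<beta> * of_int j)\<rfloor> = int i0"
    by (auto simp: i0_def nat_less_iff floor_less_iff)
  have frac_iff: "frac (\<alpha> * of_int (n i) + \<beta> * of_int (j - l i)) < 1 / real N \<longleftrightarrow> i = i0" if i: "i < N" for i
  proof -
    define y where "y = \<alpha> * of_int \<lfloor>u\<rfloor> + \<beta> * of_int j"
    obtain k where k: "\<alpha> * d i + \<beta> * of_int (l i) - real i / real N = of_int k"
      using char_value[OF i] by (auto elim: Ints_cases)
    have "\<alpha> * of_int (n i) + \<beta> * of_int (j - l i) = y - real i / real N + of_int (- k)"
      using floor_translate[OF i, of u] by (simp add: n_def y_def k[symmetric] algebra_simps)
    then have "frac (\<alpha> * of_int (n i) + \<beta> * of_int (j - l i)) = frac (y - real i / real N)"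
      by (simp only: frac_add_of_int_right)
    then show ?thesis
      using frac_shift_less_iff[OF i, of y] i0(2) by (auto simp: y_def)
  qed
  have in_iff: "(x, j) - t' \<in> unit_interval (c i) (l i) \<longleftrightarrow> t' = t i"
    if i: "i < N" and t': "t' = (of_int m + of_int j' * \<xi>, j')" for i t' m j'
  proof -
    have "c i < x - (of_int m + of_int (j - l i) * \<xi>) \<and> x - (of_int m + of_int (j - l i) * \<xi>) < c i + 1
        \<longleftrightarrow> of_int m < u - d i \<and> u - d i < of_int m + 1"
      using c_eq[OF i] by (auto simp: u_def algebra_simps)
    also have "\<dots> \<longleftrightarrow> m = n i"
    proof -
      have "u - d i \<noteq> of_int m" using x[OF i] by (auto simp: u_def)
      then show ?thesis unfolding n_def by (auto simp: eq_commute[of m] floor_eq_iff)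
    qed
    finally show ?thesis
      using t' by (cases "j' = j - l i") (auto simp: unit_interval_def t_def simp del: of_int_diff)
  qed
  have T_form: "\<exists>m j'. t' = (of_int m + of_int j' * \<xi>, j')" if "t' \<in> T" for t'
    using that by (auto simp: T_def)
  have t_T: "t i \<in> T \<longleftrightarrow> i = i0" if "i < N" for i
    unfolding frac_iff[OF that, symmetric] by (auto simp: T_def t_def)
  show ?thesis
  proof (intro bexI[of _ "t i0"] ballI)
    show "t i0 \<in> T" using t_T i0 by simp
    fix t' assume t': "t' \<in> T"
    obtain m j' where "t' = (of_int m + of_int j' * \<xi>, j')" using T_form[OF t'] by blast
    then have "(x, j) - t' \<in> \<Omega> \<longleftrightarrow> (\<exists>i<N. t' = t i)"
      using in_iff by (auto simp: \<Omega>_def)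
    then show "(x, j) - t' \<in> \<Omega> \<longleftrightarrow> t' = t i0"
      using t' t_T i0(1) by blast
  qed
qed

lemma AE_T_unique: "AE z in haar. \<exists>t0\<in>T. \<forall>t\<in>T. z - t \<in> \<Omega> \<longleftrightarrow> t = t0"
proof -
  define C where "C = (\<lambda>(i, j, m). of_int m + of_int j * \<xi> + d i) ` ({..<N} \<times> (UNIV :: int set) \<times> (UNIV :: int set))"
  have "countable C" unfolding C_def by (intro countable_image countable_SIGMA) auto
  from AE_haar_fst_notin[OF this] show ?thesis
  proof eventually_elim
    fix z :: "real \<times> int" assume z: "fst z \<notin> C"
    have "fst z - of_int (snd z) * \<xi> - d i \<notin> \<int>" if "i < N" for i
    proof
      assume "fst z - of_int (snd z) * \<xi> - d i \<in> \<int>"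
      then obtain m :: int where "fst z - of_int (snd z) * \<xi> - d i = of_int m" by (rule Ints_cases)
      then have "fst z \<in> C"
        unfolding C_def using that by (intro image_eqI[of _ _ "(i, snd z, m)"]) auto
      then show False using z by blast
    qed
    then show "\<exists>t0\<in>T. \<forall>t\<in>T. z - t \<in> \<Omega> \<longleftrightarrow> t = t0"
      using T_unique[of "fst z" "snd z"] by simp
  qed
qed

lemma tile_\<Omega>: "is_tile \<Omega>"
  unfolding is_tile_def
proof (intro conjI exI[of _ T])
  show "AE z in haar. ((\<lambda>t. indicator \<Omega> (z - t) :: real) has_sum 1) T"
    using AE_T_unique
  proof eventually_elim
    fix z assume "\<exists>t0\<in>T. \<forall>t\<in>T. z - t \<in> \<Omega> \<longleftrightarrow> t = t0"
    then obtain t0 where "t0 \<in> T" "\<And>t. t \<in> T \<Longrightarrow> z - t \<in> \<Omega> \<longleftrightarrow> t = t0" by blast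
    then show "((\<lambda>t. indicator \<Omega> (z - t) :: real) has_sum 1) T"
      by (intro has_sum_finite_neutralI[of "{t0}"]) auto
  qed
qed (use admissible_\<Omega> countable_T in auto)

text \<open>Counting measure on the tiling set works: the lattice has unit spacing on each level,
  which gives local finiteness, and the character vanishes at the origin, which gives the unit
  atom.\<close>

lemma weak_tile_\<Omega>: "is_weak_tile \<Omega>"
  unfolding is_weak_tile_def
proof (intro conjI exI[of _ "distr (count_space T) borel (\<lambda>t. t)"])
  let ?\<mu> = "distr (count_space T) borel (\<lambda>t. t)"
  have em: "emeasure ?\<mu> A = emeasure (count_space T) (A \<inter> T)" if "A \<in> sets borel" for A
    using that by (simp add: emeasure_distr)
  show "emeasure ?\<mu> {(0, 0)} = 1"
    using origin_in_T by (simp add: em)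
  show "locally_finite ?\<mu>"
    unfolding locally_finite_def
  proof
    fix z :: "real \<times> int"
    obtain x j where z: "z = (x, j)" by (cases z)
    define U where "U = {x - 1<..<x + 1} \<times> {j}"
    have "U \<inter> T \<subseteq> (\<lambda>n. (of_int n + of_int j * \<xi>, j)) ` {\<lfloor>x - 1 - of_int j * \<xi>\<rfloor>..\<lceil>x + 1 - of_int j * \<xi>\<rceil>}"
    proof
      fix t assume "t \<in> U \<inter> T"
      then obtain n where n: "t = (of_int n + of_int j * \<xi>, j)"
        "x - 1 < of_int n + of_int j * \<xi>" "of_int n + of_int j * \<xi> < x + 1"
        by (auto simp: U_def T_def)
      then have "\<lfloor>x - 1 - of_int j * \<xi>\<rfloor> \<le> n" "n \<le> \<lceil>x + 1 - of_int j * \<xi>\<rceil>"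
        by linarith+
      then show "t \<in> (\<lambda>n. (of_int n + of_int j * \<xi>, j)) ` {\<lfloor>x - 1 - of_int j * \<xi>\<rfloor>..\<lceil>x + 1 - of_int j * \<xi>\<rceil>}"
        using n(1) by auto
    qed
    then have fin: "finite (U \<inter> T)" by (rule finite_subset) auto
    have "open U" unfolding U_def by (intro open_Times open_discrete open_greaterThanLessThan)
    moreover have "emeasure ?\<mu> U < \<infinity>"
      using \<open>open U\<close> fin by (simp add: em of_nat_less_top)
    ultimately show "\<exists>U. open U \<and> z \<in> U \<and> emeasure ?\<mu> U < \<infinity>"
      by (intro exI[of _ U]) (auto simp: U_def z)
  qed
  show "AE z in haar. (\<integral>\<^sup>+ y. indicator \<Omega> (z - y) \<partial>?\<mu>) = 1"
    using AE_T_unique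
  proof eventually_elim
    fix z assume "\<exists>t0\<in>T. \<forall>t\<in>T. z - t \<in> \<Omega> \<longleftrightarrow> t = t0"
    then obtain t0 where t0: "t0 \<in> T" "\<And>t. t \<in> T \<Longrightarrow> z - t \<in> \<Omega> \<longleftrightarrow> t = t0" by blast
    define V where "V = (\<Union>i<N. {fst z - c i - 1<..<fst z - c i} \<times> {snd z - l i})"
    have "open V" unfolding V_def
      by (intro open_UN ballI open_Times open_discrete open_greaterThanLessThan)
    moreover have "z - y \<in> unit_interval (c i) (l i) \<longleftrightarrow> y \<in> {fst z - c i - 1<..<fst z - c i} \<times> {snd z - l i}"
      for y i by (cases z; cases y) (auto simp: unit_interval_def)
    then have "indicator \<Omega> (z - y) = (indicator V y :: ennreal)" for y
      by (simp add: V_def \<Omega>_def indicator_def)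
    ultimately have "(\<lambda>y. indicator \<Omega> (z - y) :: ennreal) \<in> borel_measurable borel" by simp
    then have "(\<integral>\<^sup>+ y. indicator \<Omega> (z - y) \<partial>?\<mu>) = (\<integral>\<^sup>+ y. indicator \<Omega> (z - y) \<partial>count_space T)"
      by (intro nn_integral_distr) auto
    also have "\<dots> = (\<integral>\<^sup>+ y. indicator {t0} y \<partial>count_space T)"
      using t0 by (intro nn_integral_cong) (auto simp: indicator_def)
    also have "\<dots> = 1" using t0(1) by simp
    finally show "(\<integral>\<^sup>+ y. indicator \<Omega> (z - y) \<partial>?\<mu>) = 1" .
  qed
qed (use admissible_\<Omega> in auto)

end

section \<open>Approximation in \<open>L\<^sup>2\<close>\<close>

definition lin_comb :: "'i set \<Rightarrow> ('i \<Rightarrow> 'a \<Rightarrow> complex) \<Rightarrow> ('a \<Rightarrow> complex) set" where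
  "lin_comb I e = {(\<lambda>x. \<Sum>s\<in>S. c s * e s x) | S c. finite S \<and> S \<subseteq> I}"

lemma lin_comb_base: "s \<in> I \<Longrightarrow> e s \<in> lin_comb I e"
  unfolding lin_comb_def by (auto intro!: exI[of _ "{s}"] exI[of _ "\<lambda>_. 1"])

lemma lin_comb_scale:
  assumes "u \<in> lin_comb I e"
  shows "(\<lambda>x. k * u x) \<in> lin_comb I e"
proof -
  obtain S c where "finite S" "S \<subseteq> I" "u = (\<lambda>x. \<Sum>s\<in>S. c s * e s x)"
    using assms by (auto simp: lin_comb_def)
  then show ?thesis
    unfolding lin_comb_def
    by (auto intro!: exI[of _ S] exI[of _ "\<lambda>s. k * c s"] simp: sum_distrib_left mult.assoc)
qed

lemma lin_comb_add:
  assumes "u \<in> lin_comb I e" "v \<in> lin_comb I e"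
  shows "(\<lambda>x. u x + v x) \<in> lin_comb I e"
proof -
  obtain S c where S: "finite S" "S \<subseteq> I" "u = (\<lambda>x. \<Sum>s\<in>S. c s * e s x)"
    using assms by (auto simp: lin_comb_def)
  obtain R d where R: "finite R" "R \<subseteq> I" "v = (\<lambda>x. \<Sum>s\<in>R. d s * e s x)"
    using assms by (auto simp: lin_comb_def)
  define q where "q s = (if s \<in> S then c s else 0) + (if s \<in> R then d s else 0)" for s
  have "u x + v x = (\<Sum>s\<in>S \<union> R. q s * e s x)" for x
  proof -
    have "u x = (\<Sum>s\<in>S \<union> R. (if s \<in> S then c s else 0) * e s x)"
      unfolding S(3) using S(1) R(1) by (intro sum.mono_neutral_cong_left) auto
    moreover have "v x = (\<Sum>s\<in>S \<union> R. (if s \<in> R then d s else 0) * e s x)"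
      unfolding R(3) using S(1) R(1) by (intro sum.mono_neutral_cong_left) auto
    ultimately show ?thesis by (simp add: q_def distrib_right sum.distrib)
  qed
  then show ?thesis
    unfolding lin_comb_def using S R by (auto intro!: exI[of _ "S \<union> R"] exI[of _ q])
qed

lemma lin_comb_zero: "(\<lambda>x. 0) \<in> lin_comb I e"
  unfolding lin_comb_def by (auto intro!: exI[of _ "{}"])

lemma lin_comb_sum:
  assumes "\<And>s. s \<in> S \<Longrightarrow> u s \<in> lin_comb I e"
  shows "(\<lambda>x. \<Sum>s\<in>S. u s x) \<in> lin_comb I e"
  using assms
proof (induction S rule: infinite_finite_induct)
  case (insert s S)
  then show ?case using lin_comb_add[of "u s" I e "\<lambda>x. \<Sum>s\<in>S. u s x"] by simp
qed (simp_all add: lin_comb_zero)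

lemma lin_comb_measurable:
  assumes "u \<in> lin_comb I e" "\<And>s. s \<in> I \<Longrightarrow> e s \<in> borel_measurable M"
  shows "u \<in> borel_measurable M"
proof -
  obtain S c where S: "finite S" "S \<subseteq> I" "u = (\<lambda>x. \<Sum>s\<in>S. c s * e s x)"
    using assms by (auto simp: lin_comb_def)
  have [measurable]: "e s \<in> borel_measurable M" if "s \<in> S" for s using assms(2) S(2) that by blast
  show ?thesis unfolding S(3) by measurable
qed

text \<open>The nonnegative integral measures the error even where integrability is not yet known; a
  Bochner integral would be 0 for a non-integrable error.\<close>

definition L2_approx :: "'a measure \<Rightarrow> ('a \<Rightarrow> complex) set \<Rightarrow> ('a \<Rightarrow> complex) \<Rightarrow> bool" where
  "L2_approx M V f \<longleftrightarrow> (\<forall>\<epsilon>>0. \<exists>v\<in>V. (\<integral>\<^sup>+ x. ennreal ((cmod (f x - v x))\<^sup>2) \<partial>M) < ennreal \<epsilon>)"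

lemma cmod_add_square_le: "(cmod (x + y))\<^sup>2 \<le> 2 * (cmod x)\<^sup>2 + 2 * (cmod y)\<^sup>2"
proof -
  have "(cmod (x + y))\<^sup>2 \<le> (cmod x + cmod y)\<^sup>2" by (intro power_mono norm_triangle_ineq) simp
  also have "\<dots> \<le> 2 * (cmod x)\<^sup>2 + 2 * (cmod y)\<^sup>2" using sum_squares_bound[of "cmod x" "cmod y"]
    by (simp add: power2_sum)
  finally show ?thesis .
qed

lemma nn_integral_cmod_add_square_le:
  assumes [measurable]: "f \<in> borel_measurable M" "g \<in> borel_measurable M"
  shows "(\<integral>\<^sup>+ x. ennreal ((cmod (f x + g x))\<^sup>2) \<partial>M)
    \<le> 2 * (\<integral>\<^sup>+ x. ennreal ((cmod (f x))\<^sup>2) \<partial>M) + 2 * (\<integral>\<^sup>+ x. ennreal ((cmod (g x))\<^sup>2) \<partial>M)"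
proof -
  have "(\<integral>\<^sup>+ x. ennreal ((cmod (f x + g x))\<^sup>2) \<partial>M)
      \<le> (\<integral>\<^sup>+ x. 2 * ennreal ((cmod (f x))\<^sup>2) + 2 * ennreal ((cmod (g x))\<^sup>2) \<partial>M)"
  proof (intro nn_integral_mono)
    fix x
    have "ennreal ((cmod (f x + g x))\<^sup>2) \<le> ennreal (2 * (cmod (f x))\<^sup>2 + 2 * (cmod (g x))\<^sup>2)"
      by (intro ennreal_leI cmod_add_square_le)
    then show "ennreal ((cmod (f x + g x))\<^sup>2) \<le> 2 * ennreal ((cmod (f x))\<^sup>2) + 2 * ennreal ((cmod (g x))\<^sup>2)"
      by (simp add: ennreal_plus ennreal_mult)
  qed
  then show ?thesis by (simp add: nn_integral_add nn_integral_cmult)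
qed

lemma ennreal_quarter_sum:
  assumes "x < ennreal (\<epsilon> / 4)" "y < ennreal (\<epsilon> / 4)" "\<epsilon> > 0"
  shows "2 * x + 2 * y < ennreal \<epsilon>"
proof -
  have "2 * z < ennreal (\<epsilon> / 2)" if z: "z < ennreal (\<epsilon> / 4)" for z
  proof -
    obtain r where r: "z = ennreal r" "0 \<le> r" "r < \<epsilon> / 4"
      using z assms(3) by (cases z) (auto simp: ennreal_less_iff top.not_eq_extremum)
    then have "2 * z = ennreal (2 * r)" by (simp add: ennreal_mult)
    then show ?thesis using r by (simp add: ennreal_less_iff)
  qed
  then have "2 * x + 2 * y < ennreal (\<epsilon> / 2) + ennreal (\<epsilon> / 2)"
    using assms by (intro add_strict_mono) auto
  also have "\<dots> = ennreal \<epsilon>" using assms(3) by (simp flip: ennreal_plus)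
  finally show ?thesis .
qed

locale L2_subspace =
  fixes M :: "'a measure" and V :: "('a \<Rightarrow> complex) set"
  assumes V_measurable: "v \<in> V \<Longrightarrow> v \<in> borel_measurable M"
    and V_add: "u \<in> V \<Longrightarrow> v \<in> V \<Longrightarrow> (\<lambda>x. u x + v x) \<in> V"
    and V_scale: "u \<in> V \<Longrightarrow> (\<lambda>x. k * u x) \<in> V"
begin

lemma approx_limit:
  assumes f: "f \<in> borel_measurable M" and s: "\<And>n. s n \<in> borel_measurable M" "\<And>n. L2_approx M V (s n)"
    and lim: "(\<lambda>n :: nat. \<integral>\<^sup>+ x. ennreal ((cmod (f x - s n x))\<^sup>2) \<partial>M) \<longlonglongrightarrow> 0"
  shows "L2_approx M V f"
  unfolding L2_approx_def
proof (intro allI impI)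
  fix \<epsilon> :: real assume "\<epsilon> > 0"
  then have "0 < ennreal (\<epsilon> / 4)" by simp
  then have "\<forall>\<^sub>F n in sequentially. (\<integral>\<^sup>+ x. ennreal ((cmod (f x - s n x))\<^sup>2) \<partial>M) < ennreal (\<epsilon> / 4)"
    by (rule order_tendstoD(2)[OF lim])
  then obtain n where n: "(\<integral>\<^sup>+ x. ennreal ((cmod (f x - s n x))\<^sup>2) \<partial>M) < ennreal (\<epsilon> / 4)"
    by (auto simp: eventually_sequentially)
  obtain v where v: "v \<in> V" "(\<integral>\<^sup>+ x. ennreal ((cmod (s n x - v x))\<^sup>2) \<partial>M) < ennreal (\<epsilon> / 4)"
    using s(2)[of n] \<open>\<epsilon> > 0\<close> unfolding L2_approx_def by (meson divide_pos_pos zero_less_numeral)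
  have "(\<integral>\<^sup>+ x. ennreal ((cmod ((f x - s n x) + (s n x - v x)))\<^sup>2) \<partial>M)
      \<le> 2 * (\<integral>\<^sup>+ x. ennreal ((cmod (f x - s n x))\<^sup>2) \<partial>M) + 2 * (\<integral>\<^sup>+ x. ennreal ((cmod (s n x - v x))\<^sup>2) \<partial>M)"
    by (intro nn_integral_cmod_add_square_le borel_measurable_diff f s V_measurable v)
  also have "\<dots> < ennreal \<epsilon>" by (rule ennreal_quarter_sum[OF n v(2) \<open>\<epsilon> > 0\<close>])
  finally show "\<exists>v\<in>V. (\<integral>\<^sup>+ x. ennreal ((cmod (f x - v x))\<^sup>2) \<partial>M) < ennreal \<epsilon>"
    using v(1) by auto
qed

lemma approx_dominated:
  assumes [measurable]: "f \<in> borel_measurable M" "\<And>n. s n \<in> borel_measurable M" "w \<in> borel_measurable M"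
    and s: "\<And>n. L2_approx M V (s n)"
    and lim: "AE x in M. (\<lambda>n. s n x) \<longlonglongrightarrow> f x"
    and bound: "\<And>n. AE x in M. (cmod (f x - s n x))\<^sup>2 \<le> w x"
    and w: "(\<integral>\<^sup>+ x. ennreal (w x) \<partial>M) < \<infinity>"
  shows "L2_approx M V f"
proof (rule approx_limit[OF _ _ s])
  have "(\<lambda>n. \<integral>\<^sup>+ x. ennreal ((cmod (f x - s n x))\<^sup>2) \<partial>M) \<longlonglongrightarrow> (\<integral>\<^sup>+ x. 0 \<partial>M)"
  proof (rule nn_integral_dominated_convergence[where w = "\<lambda>x. ennreal (w x)"])
    show "AE x in M. ennreal ((cmod (f x - s n x))\<^sup>2) \<le> ennreal (w x)" for n
      using bound[of n] by eventually_elim (rule ennreal_leI)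
    show "AE x in M. (\<lambda>n. ennreal ((cmod (f x - s n x))\<^sup>2)) \<longlonglongrightarrow> 0"
      using lim
    proof eventually_elim
      fix x assume "(\<lambda>n. s n x) \<longlonglongrightarrow> f x"
      then have "(\<lambda>n. (cmod (f x - s n x))\<^sup>2) \<longlonglongrightarrow> (cmod (f x - f x))\<^sup>2"
        by (intro tendsto_intros)
      then show "(\<lambda>n. ennreal ((cmod (f x - s n x))\<^sup>2)) \<longlonglongrightarrow> 0"
        using tendsto_ennrealI by fastforce
    qed
  qed (use w in measurable)
  then show "(\<lambda>n. \<integral>\<^sup>+ x. ennreal ((cmod (f x - s n x))\<^sup>2) \<partial>M) \<longlonglongrightarrow> 0" by simp
qed measurable

lemma approx_add:
  assumes f: "f \<in> borel_measurable M" "L2_approx M V f" and g: "g \<in> borel_measurable M" "L2_approx M V g"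
  shows "L2_approx M V (\<lambda>x. f x + g x)"
  unfolding L2_approx_def
proof (intro allI impI)
  fix \<epsilon> :: real assume "\<epsilon> > 0"
  then have "\<epsilon> / 4 > 0" by simp
  obtain u where u: "u \<in> V" "(\<integral>\<^sup>+ x. ennreal ((cmod (f x - u x))\<^sup>2) \<partial>M) < ennreal (\<epsilon> / 4)"
    using f(2) \<open>\<epsilon> / 4 > 0\<close> unfolding L2_approx_def by meson
  obtain v where v: "v \<in> V" "(\<integral>\<^sup>+ x. ennreal ((cmod (g x - v x))\<^sup>2) \<partial>M) < ennreal (\<epsilon> / 4)"
    using g(2) \<open>\<epsilon> / 4 > 0\<close> unfolding L2_approx_def by meson
  have "(\<integral>\<^sup>+ x. ennreal ((cmod ((f x - u x) + (g x - v x)))\<^sup>2) \<partial>M)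
      \<le> 2 * (\<integral>\<^sup>+ x. ennreal ((cmod (f x - u x))\<^sup>2) \<partial>M) + 2 * (\<integral>\<^sup>+ x. ennreal ((cmod (g x - v x))\<^sup>2) \<partial>M)"
    by (intro nn_integral_cmod_add_square_le borel_measurable_diff f g V_measurable u v)
  also have "\<dots> < ennreal \<epsilon>" by (rule ennreal_quarter_sum[OF u(2) v(2) \<open>\<epsilon> > 0\<close>])
  finally show "\<exists>v\<in>V. (\<integral>\<^sup>+ x. ennreal ((cmod (f x + g x - v x))\<^sup>2) \<partial>M) < ennreal \<epsilon>"
    using V_add[OF u(1) v(1)] by (intro bexI[of _ "\<lambda>x. u x + v x"]) (simp_all add: algebra_simps)
qed

lemma approx_scale:
  assumes [measurable]: "f \<in> borel_measurable M" and f: "L2_approx M V f"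
  shows "L2_approx M V (\<lambda>x. k * f x)"
  unfolding L2_approx_def
proof (intro allI impI)
  fix \<epsilon> :: real assume "\<epsilon> > 0"
  \<comment> \<open>The summand 1 keeps \<open>K\<close> positive when \<open>k = 0\<close>, so that
    division by it is possible.\<close>
  define K where "K = (cmod k)\<^sup>2 + 1"
  have "K > 0" by (simp add: K_def add_nonneg_pos)
  then have "\<epsilon> / K > 0" using \<open>\<epsilon> > 0\<close> by simp
  then obtain u where u: "u \<in> V" "(\<integral>\<^sup>+ x. ennreal ((cmod (f x - u x))\<^sup>2) \<partial>M) < ennreal (\<epsilon> / K)"
    using f unfolding L2_approx_def by meson
  have [measurable]: "u \<in> borel_measurable M" using u V_measurable by blast
  have "(\<integral>\<^sup>+ x. ennreal ((cmod (k * f x - k * u x))\<^sup>2) \<partial>M) \<le> (\<integral>\<^sup>+ x. ennreal K * ennreal ((cmod (f x - u x))\<^sup>2) \<partial>M)"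
  proof (intro nn_integral_mono)
    fix x
    have "(cmod (k * f x - k * u x))\<^sup>2 = (cmod k)\<^sup>2 * (cmod (f x - u x))\<^sup>2"
      by (simp flip: right_diff_distrib add: norm_mult power_mult_distrib)
    also have "\<dots> \<le> K * (cmod (f x - u x))\<^sup>2" by (intro mult_right_mono) (auto simp: K_def)
    finally show "ennreal ((cmod (k * f x - k * u x))\<^sup>2) \<le> ennreal K * ennreal ((cmod (f x - u x))\<^sup>2)"
      using \<open>K > 0\<close> by (simp flip: ennreal_mult add: ennreal_leI)
  qed
  also have "\<dots> = ennreal K * (\<integral>\<^sup>+ x. ennreal ((cmod (f x - u x))\<^sup>2) \<partial>M)"
    by (rule nn_integral_cmult) measurable
  also have "\<dots> < ennreal K * ennreal (\<epsilon> / K)"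
    using u(2) \<open>K > 0\<close> by (intro ennreal_mult_strict_left_mono) auto
  also have "\<dots> = ennreal \<epsilon>" using \<open>K > 0\<close> \<open>\<epsilon> > 0\<close> by (simp flip: ennreal_mult)
  finally show "\<exists>v\<in>V. (\<integral>\<^sup>+ x. ennreal ((cmod (k * f x - v x))\<^sup>2) \<partial>M) < ennreal \<epsilon>"
    using V_scale[OF u(1), of k] by (intro bexI[of _ "\<lambda>x. k * u x"])
qed

text \<open>\<open>L2_subspace\<close> allows an empty \<open>V\<close>, so the zero function need
  not be approximable and the induction starts from a singleton.\<close>

lemma approx_sum:
  assumes "finite S" "S \<noteq> {}" "\<And>s. s \<in> S \<Longrightarrow> f s \<in> borel_measurable M" "\<And>s. s \<in> S \<Longrightarrow> L2_approx M V (f s)"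
  shows "L2_approx M V (\<lambda>x. \<Sum>s\<in>S. f s x)"
  using assms
proof (induction S rule: finite_ne_induct)
  case (insert s S)
  then show ?case
    using approx_add[of "f s" "\<lambda>x. \<Sum>s\<in>S. f s x"] by (simp add: borel_measurable_sum)
qed simp

end

text \<open>Open sets are stable under intersection and generate the Borel sets, so the approximable
  indicators exhaust them by closure under complements and disjoint unions (finite measure gives the
  dominating constant). Simple functions follow by linearity, and all square-integrable functions by
  dominated convergence.\<close>

lemma L2_approx_of_open:
  fixes M :: "'a::topological_space measure"
  assumes "L2_subspace M V" "finite_measure M" and sets: "sets M = sets borel"
    and op: "\<And>U. open U \<Longrightarrow> L2_approx M V (indicator U)"
    and f: "f \<in> borel_measurable M" "(\<integral>\<^sup>+ x. ennreal ((cmod (f x))\<^sup>2) \<partial>M) < \<infinity>"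
  shows "L2_approx M V f"
proof -
  interpret L2_subspace M V by fact
  interpret finite_measure M by fact
  have space: "space M = UNIV" using sets_eq_imp_space_eq[OF sets] by simp
  have ind: "L2_approx M V (indicator A)" if "A \<in> sets borel" for A
  proof -
    have "Int_stable {U :: 'a set. open U}" by (auto intro: Int_stableI)
    moreover have "{U :: 'a set. open U} \<subseteq> Pow UNIV" by simp
    moreover have "A \<in> sigma_sets UNIV {U. open U}" using that by (simp add: borel_def)
    ultimately show ?thesis
    proof (induction rule: sigma_sets_induct_disjoint)
      case empty
      show ?case by (rule op) simp
    next
      case (compl A)
      then have [measurable]: "A \<in> sets M" by (simp add: sets borel_def)
      have "L2_approx M V (\<lambda>x. indicator UNIV x + (- 1) * indicator A x)"
        using op[of UNIV] compl.IH by (intro approx_add approx_scale) (auto simp: sets)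
      moreover have "indicator (UNIV - A) = (\<lambda>x. indicator UNIV x + (- 1) * indicator A x :: complex)"
        by (auto simp: indicator_def)
      ultimately show ?case by metis
    next
      case (union A)
      then have [measurable]: "A i \<in> sets M" for i by (auto simp: sets borel_def)
      have part: "L2_approx M V (\<lambda>x. \<Sum>i\<le>n. indicator (A i) x)" for n
        using union.IH by (intro approx_sum) auto
      have eq: "(\<Sum>i\<le>n. indicator (A i) x) = (indicator (\<Union>i\<le>n. A i) x :: complex)" for n x
        using union.hyps(1) by (intro indicator_UN_disjoint[symmetric]) (auto simp: disjoint_family_on_def)
      show ?case
      proof (rule approx_dominated[OF _ _ _ part, where w = "\<lambda>_. 1"])
        show "AE x in M. (\<lambda>n. \<Sum>i\<le>n. indicator (A i) x) \<longlonglongrightarrow> (indicator (\<Union>i. A i) x :: complex)"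
        proof (intro AE_I2)
          fix x
          show "(\<lambda>n. \<Sum>i\<le>n. indicator (A i) x) \<longlonglongrightarrow> (indicator (\<Union>i. A i) x :: complex)"
            unfolding eq using LIMSEQ_Suc[OF LIMSEQ_indicator_UN[of A x]]
            by (simp add: lessThan_Suc_atMost)
        qed
        show "AE x in M. (cmod (indicator (\<Union>i. A i) x - (\<Sum>i\<le>n. indicator (A i) x)))\<^sup>2 \<le> 1" for n
          unfolding eq by (intro AE_I2) (auto simp: indicator_def)
      qed (auto simp: emeasure_eq_measure)
    qed (use op in \<open>auto simp: open_Int\<close>)
  qed
  have simple: "L2_approx M V s" if s: "simple_function M s" for s
  proof -
    have "finite (range s)" and vs: "s -` {y} \<in> sets M" for y
      using simple_functionD[OF s] by (simp_all add: space)
    have eq: "s = (\<lambda>x. \<Sum>y\<in>range s. y * indicator (s -` {y}) x)"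
    proof
      fix x
      have "(\<Sum>y\<in>range s. y * indicator (s -` {y}) x) = (\<Sum>y\<in>{s x}. y * indicator (s -` {y}) x)"
        using \<open>finite (range s)\<close> by (intro sum.mono_neutral_right) (auto simp: indicator_def)
      then show "s x = (\<Sum>y\<in>range s. y * indicator (s -` {y}) x)" by simp
    qed
    have "L2_approx M V (\<lambda>x. \<Sum>y\<in>range s. y * indicator (s -` {y}) x)"
    proof (rule approx_sum)
      fix y assume "y \<in> range s"
      have [measurable]: "s -` {y} \<in> sets M" by (rule vs)
      show "(\<lambda>x. y * indicator (s -` {y}) x) \<in> borel_measurable M" by measurable
      show "L2_approx M V (\<lambda>x. y * indicator (s -` {y}) x)"
        using vs[of y] by (intro approx_scale ind) (auto simp: sets)
    qed (use \<open>finite (range s)\<close> in auto)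
    then show ?thesis by (simp flip: eq)
  qed
  obtain s where s: "\<And>i. simple_function M (s i)" "\<And>x. (\<lambda>i. s i x) \<longlonglongrightarrow> f x"
    "\<And>i x. dist (s i x) 0 \<le> 2 * dist (f x) 0"
    using borel_measurable_implies_sequence_metric[OF f(1), of 0] by (auto simp: space)
  show ?thesis
  \<comment> \<open>The simple approximants are bounded by \<open>2 * cmod (f x)\<close>, so the
    difference is at most \<open>3 * cmod (f x)\<close>, whence the 9.\<close>
  proof (rule approx_dominated[where s = s and w = "\<lambda>x. 9 * (cmod (f x))\<^sup>2"])
    show "L2_approx M V (s n)" for n by (rule simple[OF s(1)])
    show "s n \<in> borel_measurable M" for n by (rule borel_measurable_simple_function[OF s(1)])
    show "AE x in M. (cmod (f x - s n x))\<^sup>2 \<le> 9 * (cmod (f x))\<^sup>2" for n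
    proof (intro AE_I2)
      fix x
      have "cmod (f x - s n x) \<le> 3 * cmod (f x)"
        using norm_triangle_ineq4[of "f x" "s n x"] s(3)[of n x] by simp
      then have "(cmod (f x - s n x))\<^sup>2 \<le> (3 * cmod (f x))\<^sup>2" by (intro power_mono) auto
      then show "(cmod (f x - s n x))\<^sup>2 \<le> 9 * (cmod (f x))\<^sup>2" by (simp add: power_mult_distrib)
    qed
    show "(\<integral>\<^sup>+ x. ennreal (9 * (cmod (f x))\<^sup>2) \<partial>M) < \<infinity>"
      using f by (simp add: ennreal_mult nn_integral_cmult ennreal_mult_less_top)
  qed (use f s borel_measurable_simple_function in auto)
qed

section \<open>Trigonometric polynomials on the unit interval\<close>

text \<open>A density on the whole line, rather than a restricted space, keeps the Borel sets of the
  line, as \<open>L2_approx_of_open\<close> demands.\<close>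

definition unit_measure :: "real measure" where
  "unit_measure = density lborel (indicator {0<..<1})"

lemma sets_unit_measure [measurable_cong]: "sets unit_measure = sets borel"
  by (simp add: unit_measure_def)

lemma space_unit_measure: "space unit_measure = UNIV"
  by (simp add: unit_measure_def)

lemma emeasure_unit_measure_UNIV: "emeasure unit_measure UNIV = 1"
  by (simp add: unit_measure_def emeasure_density)

lemma finite_unit_measure: "finite_measure unit_measure"
  by (intro finite_measureI) (simp add: space_unit_measure emeasure_unit_measure_UNIV)

lemma AE_unit_measure_iff: "(AE u in unit_measure. P u) \<longleftrightarrow> (AE u in lborel. 0 < u \<and> u < 1 \<longrightarrow> P u)"
  unfolding unit_measure_def by (subst AE_density) (auto simp: indicator_def)

definition trig :: "int \<Rightarrow> real \<Rightarrow> complex" where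
  "trig k u = cis (2 * pi * (of_int k * u))"

lemma trig_measurable [measurable]: "trig k \<in> borel_measurable borel"
  unfolding trig_def[abs_def] cis_conv_exp by measurable

abbreviation trig_polys :: "(real \<Rightarrow> complex) set" where
  "trig_polys \<equiv> lin_comb UNIV trig"

lemma trig_mult: "trig k u * trig m u = trig (k + m) u"
  by (simp add: trig_def cis_mult algebra_simps)

lemma trig_polys_mult:
  assumes "p \<in> trig_polys" "q \<in> trig_polys"
  shows "(\<lambda>u. p u * q u) \<in> trig_polys"
proof -
  obtain S c where S: "p = (\<lambda>u. \<Sum>s\<in>S. c s * trig s u)" using assms(1) by (auto simp: lin_comb_def)
  obtain R d where R: "q = (\<lambda>u. \<Sum>r\<in>R. d r * trig r u)" using assms(2) by (auto simp: lin_comb_def)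
  have "(\<lambda>u. p u * q u) = (\<lambda>u. \<Sum>s\<in>S. \<Sum>r\<in>R. (c s * d r) * trig (s + r) u)"
    unfolding S R sum_product trig_mult[symmetric] by (simp add: mult_ac)
  then show ?thesis
    by (auto intro!: lin_comb_sum lin_comb_scale lin_comb_base)
qed

text \<open>Stone-Weierstrass on the unit circle supplies polynomials in the real coordinates of the
  plane; this turns them into trigonometric polynomials.\<close>

lemma real_polynomial_function_trig:
  assumes "real_polynomial_function p"
  shows "(\<lambda>u. complex_of_real (p (trig 1 u))) \<in> trig_polys"
  using assms
proof induction
  case (linear f)
  \<comment> \<open>A real-linear functional on the plane is determined by its values at 1 and
    \<open>\<i>\<close>; \<open>A\<close> and its conjugate \<open>B\<close> are the coefficients
    obtained from Euler's formula.\<close>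
  define A where "A = Complex (f 1 / 2) (- f \<i> / 2)"
  define B where "B = Complex (f 1 / 2) (f \<i> / 2)"
  have "complex_of_real (f (trig 1 u)) = A * trig 1 u + B * trig (- 1) u" for u
  proof -
    have "trig 1 u = cos (2 * pi * u) *\<^sub>R 1 + sin (2 * pi * u) *\<^sub>R \<i>"
      by (simp add: trig_def complex_eq_iff)
    then have "f (trig 1 u) = cos (2 * pi * u) * f 1 + sin (2 * pi * u) * f \<i>"
      using linear by (simp add: linear_add linear_cmul bounded_linear.linear)
    then show ?thesis by (simp add: trig_def complex_eq_iff A_def B_def algebra_simps)
  qed
  then show ?case by (simp only:) (intro lin_comb_add lin_comb_scale lin_comb_base UNIV_I)
next
  case (const c)
  have "(\<lambda>u. complex_of_real c * trig 0 u) \<in> trig_polys"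
    by (intro lin_comb_scale lin_comb_base UNIV_I)
  moreover have "trig 0 u = 1" for u by (simp add: trig_def)
  ultimately show ?case by simp
next
  case (add f g)
  then show ?case by (simp add: lin_comb_add)
next
  case (mult f g)
  then show ?case by (simp add: trig_polys_mult)
qed

text \<open>The only coincidence of \<open>trig 1\<close> on the closed unit interval is between 0
  and 1, and \<open>x\<close> is an interior point.\<close>

lemma trig_1_eq_imp:
  assumes "trig 1 x = trig 1 y" "0 < x" "x < 1" "0 \<le> y" "y \<le> 1"
  shows "x = y"
proof -
  have "cis (2 * pi * (x - y)) = 1"
    using assms(1) by (simp add: trig_def right_diff_distrib flip: cis_divide)
  then have "cos (2 * pi * (x - y)) = 1" by (metis cis.sel(1) one_complex.sel(1))
  then obtain n :: int where "2 * pi * (x - y) = of_int n * 2 * pi" by (auto simp: cos_one_2pi_int)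
  then have n: "x - y = of_int n" by simp
  then have "\<bar>real_of_int n\<bar> < 1" using assms(2-) by linarith
  then have "n = 0" by linarith
  then show ?thesis using n by simp
qed

lemma trig_polys_L2_subspace: "L2_subspace unit_measure trig_polys"
proof
  fix p assume "p \<in> trig_polys"
  then show "p \<in> borel_measurable unit_measure" by (rule lin_comb_measurable) measurable
qed (auto intro: lin_comb_add lin_comb_scale)

lemma trig_polys_approx_circle_function:
  fixes g :: "complex \<Rightarrow> real"
  assumes "continuous_on UNIV g"
  shows "L2_approx unit_measure trig_polys (\<lambda>u. complex_of_real (g (trig 1 u)))"
  unfolding L2_approx_def
proof (intro allI impI)
  fix \<epsilon> :: real assume "\<epsilon> > 0"
  then have "sqrt (\<epsilon> / 2) > 0" by simp
  then obtain p where p: "real_polynomial_function p" "\<And>z. z \<in> sphere 0 1 \<Longrightarrow> \<bar>g z - p z\<bar> < sqrt (\<epsilon> / 2)"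
    using Stone_Weierstrass_real_polynomial_function[OF compact_sphere continuous_on_subset[OF assms subset_UNIV]]
    by metis
  have "(\<integral>\<^sup>+ u. ennreal ((cmod (complex_of_real (g (trig 1 u)) - complex_of_real (p (trig 1 u))))\<^sup>2) \<partial>unit_measure)
      \<le> (\<integral>\<^sup>+ u. ennreal (\<epsilon> / 2) \<partial>unit_measure)"
  proof (intro nn_integral_mono ennreal_leI)
    fix u
    have "\<bar>g (trig 1 u) - p (trig 1 u)\<bar> \<le> sqrt (\<epsilon> / 2)"
      by (intro less_imp_le p) (simp add: trig_def)
    then have "\<bar>g (trig 1 u) - p (trig 1 u)\<bar>\<^sup>2 \<le> (sqrt (\<epsilon> / 2))\<^sup>2" by (intro power_mono) auto
    then show "(cmod (complex_of_real (g (trig 1 u)) - complex_of_real (p (trig 1 u))))\<^sup>2 \<le> \<epsilon> / 2"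
      using \<open>\<epsilon> > 0\<close> by (simp flip: of_real_diff)
  qed
  also have "\<dots> = ennreal (\<epsilon> / 2)"
    by (simp add: space_unit_measure emeasure_unit_measure_UNIV)
  also have "\<dots> < ennreal \<epsilon>" using \<open>\<epsilon> > 0\<close> by (intro ennreal_lessI) auto
  finally show "\<exists>v\<in>trig_polys. (\<integral>\<^sup>+ u. ennreal ((cmod (complex_of_real (g (trig 1 u)) - v u))\<^sup>2) \<partial>unit_measure) < ennreal \<epsilon>"
    using real_polynomial_function_trig[OF p(1)] by (intro bexI[of _ "\<lambda>u. complex_of_real (p (trig 1 u))"])
qed

lemma trig_polys_approx_open:
  assumes "open U"
  shows "L2_approx unit_measure trig_polys (indicator U)"
proof -
  interpret L2_subspace unit_measure trig_polys by (rule trig_polys_L2_subspace)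
  (* Working with distances on the circle makes the approximants periodic for free. *)
  define C where "C = trig 1 ` ({0..1} - U \<inter> {0<..<1})"
  have "continuous_on ({0..1} - U \<inter> {0<..<1}) (trig 1)"
    unfolding trig_def[abs_def] by (intro continuous_intros)
  then have "closed C" unfolding C_def
    using assms by (intro compact_imp_closed compact_continuous_image compact_diff open_Int) auto
  \<comment> \<open>An endpoint never lies in the open unit interval, so \<open>C\<close> is
    nonempty for every \<open>U\<close> and \<open>infdist\<close> is a genuine distance to
    it.\<close>
  moreover have "trig 1 0 \<in> C" unfolding C_def by (intro imageI) auto
  then have "C \<noteq> {}" by blast
  ultimately have inC: "z \<in> C \<longleftrightarrow> infdist z C = 0" for z by (rule in_closed_iff_infdist_zero)
  define g where "g n z = min 1 (real n * infdist z C)" for n z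
  have g01: "0 \<le> g n z" "g n z \<le> 1" for n z by (auto simp: g_def infdist_nonneg)
  have cont: "continuous_on UNIV (g n)" for n unfolding g_def by (intro continuous_intros)
  have ap: "L2_approx unit_measure trig_polys (\<lambda>u. complex_of_real (g n (trig 1 u)))" for n
    using cont by (rule trig_polys_approx_circle_function)
  have [measurable]: "g n \<in> borel_measurable borel" for n
    using cont by (rule borel_measurable_continuous_onI)
  have [measurable]: "U \<in> sets borel" using assms by simp
  show ?thesis
  proof (rule approx_dominated[OF _ _ _ ap, where w = "\<lambda>_. 1"])
    show "AE u in unit_measure. (\<lambda>n. complex_of_real (g n (trig 1 u))) \<longlonglongrightarrow> indicator U u"
      unfolding AE_unit_measure_iff
    proof (intro AE_I2 impI)
      fix u :: real assume u: "0 < u \<and> u < 1"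
      have C_iff: "trig 1 u \<in> C \<longleftrightarrow> u \<notin> U"
      proof
        assume "trig 1 u \<in> C"
        then obtain y where y: "trig 1 u = trig 1 y" "y \<in> {0..1} - U \<inter> {0<..<1}"
          unfolding C_def by (rule imageE)
        then have "u = y" using u by (intro trig_1_eq_imp) auto
        then show "u \<notin> U" using y(2) u by auto
      next
        assume "u \<notin> U"
        then show "trig 1 u \<in> C" using u by (auto simp: C_def)
      qed
      show "(\<lambda>n. complex_of_real (g n (trig 1 u))) \<longlonglongrightarrow> indicator U u"
      proof (cases "u \<in> U")
        case True
        then have "infdist (trig 1 u) C > 0" using C_iff inC infdist_nonneg[of "trig 1 u" C] by force
        then obtain n0 :: nat where n0: "1 < real n0 * infdist (trig 1 u) C"
          using reals_Archimedean3 by blast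
        have "complex_of_real (g n (trig 1 u)) = indicator U u" if "n \<ge> n0" for n
        proof -
          have "real n0 * infdist (trig 1 u) C \<le> real n * infdist (trig 1 u) C"
            using that by (intro mult_right_mono infdist_nonneg) auto
          then show ?thesis using n0 True by (simp add: g_def min_def)
        qed
        then show ?thesis by (intro tendsto_eventually) (auto simp: eventually_sequentially)
      next
        case False
        then show ?thesis using C_iff inC by (simp add: g_def)
      qed
    qed
    show "AE u in unit_measure. (cmod (indicator U u - complex_of_real (g n (trig 1 u))))\<^sup>2 \<le> 1" for n
    proof (intro AE_I2)
      fix u
      have "\<bar>indicator U u - g n (trig 1 u)\<bar> \<le> 1" using g01[of n "trig 1 u"] by (auto simp: indicator_def)
      then have "\<bar>indicator U u - g n (trig 1 u)\<bar>\<^sup>2 \<le> 1" by (intro power_le_one abs_ge_zero)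
      moreover have "cmod (indicator U u - complex_of_real (g n (trig 1 u))) = \<bar>indicator U u - g n (trig 1 u)\<bar>"
        by (metis norm_of_real of_real_diff of_real_indicator)
      ultimately show "(cmod (indicator U u - complex_of_real (g n (trig 1 u))))\<^sup>2 \<le> 1" by simp
    qed
    show "(\<integral>\<^sup>+ x. ennreal 1 \<partial>unit_measure) < \<infinity>"
      by (simp add: space_unit_measure emeasure_unit_measure_UNIV)
  qed measurable
qed

lemma trig_polys_dense:
  assumes "f \<in> borel_measurable borel" "(\<integral>\<^sup>+ u. ennreal ((cmod (f u))\<^sup>2) \<partial>unit_measure) < \<infinity>"
  shows "L2_approx unit_measure trig_polys f"
  using assms
  by (intro L2_approx_of_open[OF trig_polys_L2_subspace finite_unit_measure sets_unit_measure
      trig_polys_approx_open]) (auto simp: measurable_cong_sets[OF sets_unit_measure refl])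

lemma integral_unit_measure_cis:
  assumes "t \<noteq> 0" "t \<in> \<int>"
  shows "(\<integral>u. cis (2 * pi * (t * u)) \<partial>unit_measure) = 0"
proof -
  define F where "F u = cis (2 * pi * (t * u)) / (\<i> * complex_of_real (2 * pi * t))" for u
  have nz: "\<i> * complex_of_real (2 * pi * t) \<noteq> 0" using assms(1) by simp
  have "(\<integral>u. cis (2 * pi * (t * u)) \<partial>unit_measure)
      = (\<integral>u. indicator {0<..<1} u *\<^sub>R cis (2 * pi * (t * u)) \<partial>lborel)"
  proof -
    have unit: "unit_measure = density lborel (\<lambda>u. ennreal (indicator {0<..<1} u))"
      by (simp add: unit_measure_def ennreal_indicator)
    show ?thesis unfolding unit cis_conv_exp by (rule integral_density) auto
  qed
  also have "\<dots> = (\<integral>u. indicator {0..1} u *\<^sub>R cis (2 * pi * (t * u)) \<partial>lborel)"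
  proof (intro integral_cong_AE)
    have "AE u in lborel. u \<noteq> 0 \<and> u \<noteq> (1 :: real)"
      using AE_lborel_singleton[of 0] AE_lborel_singleton[of "1 :: real"] by eventually_elim auto
    then show "AE u in lborel. indicator {0<..<1} u *\<^sub>R cis (2 * pi * (t * u))
        = indicator {0..1} u *\<^sub>R cis (2 * pi * (t * u))"
      by eventually_elim (auto simp: indicator_def)
  qed (auto simp: cis_conv_exp)
  also have "\<dots> = F 1 - F 0"
  proof (rule integral_FTC_Icc)
    fix u :: real
    have "((\<lambda>u. exp (\<i> * complex_of_real (2 * pi * t) * complex_of_real u) / (\<i> * complex_of_real (2 * pi * t)))
        has_vector_derivative (exp (\<i> * complex_of_real (2 * pi * t) * complex_of_real u))) (at u within {0..1})"
      by (rule has_vector_derivative_real_field) (use nz in \<open>auto intro!: derivative_eq_intros\<close>)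
    moreover have "cis (2 * pi * (t * u)) = exp (\<i> * complex_of_real (2 * pi * t) * complex_of_real u)" for u
      by (simp add: cis_conv_exp mult_ac)
    ultimately show "(F has_vector_derivative cis (2 * pi * (t * u))) (at u within {0..1})"
      unfolding F_def by simp
  qed (auto intro!: continuous_intros)
  also have "\<dots> = 0"
    using assms(2) cis_multiple_2pi[of t] by (simp add: F_def diff_divide_distrib[symmetric])
  finally show ?thesis .
qed

section \<open>The spectrum\<close>

lemma measurable_embedding [measurable]: "(\<lambda>u. (c + u, l)) \<in> measurable unit_measure haar"
  unfolding measurable_cong_sets[OF sets_unit_measure refl] by measurable

text \<open>Every interval becomes a copy of one model space, so the spectral argument reduces to
  vectors of functions on the unit interval.\<close>

lemma distr_unit_measure_haar:
  "distr unit_measure haar (\<lambda>u. (c + u, l)) = density haar (indicator (unit_interval c l))"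
proof (rule measure_eqI)
  have [measurable]: "unit_interval c l \<in> sets haar" by (rule unit_interval_sets)
  fix A assume "A \<in> sets (distr unit_measure haar (\<lambda>u. (c + u, l)))"
  then have [measurable]: "A \<in> sets haar" by simp
  have [measurable]: "{x. (x, l) \<in> A} \<in> sets borel"
    using measurable_sets[OF _ \<open>A \<in> sets haar\<close>, of "\<lambda>x. (x, l)" borel] by (simp add: vimage_def)
  have "emeasure (distr unit_measure haar (\<lambda>u. (c + u, l))) A
      = emeasure unit_measure {u. (c + u, l) \<in> A}"
    by (simp add: emeasure_distr space_unit_measure vimage_def)
  also have "\<dots> = (\<integral>\<^sup>+ u. indicator {0<..<1} u * indicator {x. (x, l) \<in> A} (c + 1 * u) \<partial>lborel)"
  proof -
    have "{u. (c + u, l) \<in> A} \<in> sets borel"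
      using measurable_sets[OF _ \<open>A \<in> sets haar\<close>, of "\<lambda>u. (c + u, l)" borel] by (simp add: vimage_def)
    then show ?thesis unfolding unit_measure_def
      by (subst emeasure_density) (auto intro!: nn_integral_cong simp: indicator_def)
  qed
  also have "\<dots> = (\<integral>\<^sup>+ x. indicator {c<..<c + 1} x * indicator {x. (x, l) \<in> A} x \<partial>lborel)"
    by (subst (2) nn_integral_real_affine[of _ 1 c]) (auto intro!: nn_integral_cong simp: indicator_def)
  also have "\<dots> = (\<integral>\<^sup>+ x. emeasure (count_space UNIV) (Pair x -` (A \<inter> unit_interval c l)) \<partial>lborel)"
  proof (intro nn_integral_cong)
    fix x
    have "Pair x -` (A \<inter> unit_interval c l) = (if x \<in> {c<..<c + 1} \<and> (x, l) \<in> A then {l} else {})"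
      by (auto simp: unit_interval_def)
    then show "indicator {c<..<c + 1} x * indicator {x. (x, l) \<in> A} x
        = emeasure (count_space UNIV) (Pair x -` (A \<inter> unit_interval c l))"
      by (auto simp: indicator_def)
  qed
  also have "\<dots> = emeasure haar (A \<inter> unit_interval c l)"
    by (intro haar.M2.emeasure_pair_measure_alt[symmetric]) measurable
  also have "\<dots> = emeasure (density haar (indicator (unit_interval c l))) A"
    by (subst emeasure_density) (auto simp: indicator_inter_arith[symmetric] nn_integral_indicator mult.commute Int_commute simp flip: indicator_inter_arith)
  finally show "emeasure (distr unit_measure haar (\<lambda>u. (c + u, l))) A
      = emeasure (density haar (indicator (unit_interval c l))) A" .
qed simp

lemma nn_integral_unit_interval:
  assumes [measurable]: "g \<in> borel_measurable haar"
  shows "(\<integral>\<^sup>+ z. indicator (unit_interval c l) z * g z \<partial>haar) = (\<integral>\<^sup>+ u. g (c + u, l) \<partial>unit_measure)"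
proof -
  have [measurable]: "unit_interval c l \<in> sets haar" by (rule unit_interval_sets)
  have "(\<integral>\<^sup>+ z. indicator (unit_interval c l) z * g z \<partial>haar)
      = (\<integral>\<^sup>+ z. g z \<partial>density haar (indicator (unit_interval c l)))"
    by (subst nn_integral_density) auto
  also have "\<dots> = (\<integral>\<^sup>+ u. g (c + u, l) \<partial>unit_measure)"
    unfolding distr_unit_measure_haar[symmetric] by (subst nn_integral_distr) auto
  finally show ?thesis .
qed

lemma integral_unit_interval:
  fixes g :: "real \<times> int \<Rightarrow> complex"
  assumes [measurable]: "g \<in> borel_measurable haar"
  shows "(\<integral> z. indicator (unit_interval c l) z *\<^sub>R g z \<partial>haar) = (\<integral> u. g (c + u, l) \<partial>unit_measure)"
proof -
  have [measurable]: "unit_interval c l \<in> sets haar" by (rule unit_interval_sets)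
  have "(\<integral> z. indicator (unit_interval c l) z *\<^sub>R g z \<partial>haar)
      = (\<integral> z. g z \<partial>density haar (\<lambda>z. ennreal (indicator (unit_interval c l) z)))"
    by (subst integral_density) auto
  also have "\<dots> = (\<integral> u. g (c + u, l) \<partial>unit_measure)"
    unfolding ennreal_indicator distr_unit_measure_haar[symmetric] by (subst integral_distr) auto
  finally show ?thesis .
qed

lemma sum_cis_root_of_unity:
  fixes r :: int
  assumes "0 < \<bar>r\<bar>" "\<bar>r\<bar> < int N"
  shows "(\<Sum>i<N. cis (2 * pi * (of_int r * real i / real N))) = 0"
proof -
  have N: "0 < N" using assms by linarith
  define z where "z = cis (2 * pi * (of_int r / real N))"
  have "z \<noteq> 1"
  proof
    assume "z = 1"
    then have "cos (2 * pi * (of_int r / real N)) = 1" by (metis z_def cis.sel(1) one_complex.sel(1))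
    then obtain n :: int where "2 * pi * (of_int r / real N) = of_int n * 2 * pi" by (auto simp: cos_one_2pi_int)
    then have "2 * pi * (of_int r / real N) = 2 * pi * of_int n" by (simp only: mult_ac)
    then have "of_int r / real N = of_int n" by (subst (asm) mult_left_cancel) auto
    then have "real_of_int r = of_int (n * int N)" using N by (simp add: field_simps)
    then have "r = n * int N" by (simp only: of_int_eq_iff)
    then have "int N dvd \<bar>r\<bar>" by simp
    then show False using assms zdvd_imp_le by fastforce
  qed
  moreover have "z ^ N = 1"
  proof -
    have "real N * (2 * pi * (of_int r / real N)) = 2 * pi * of_int r" using N by simp
    then have "z ^ N = cis (2 * pi * of_int r)" by (simp only: z_def Complex.DeMoivre)
    then show ?thesis by (simp add: cis_multiple_2pi)
  qed
  moreover have "cis (2 * pi * (of_int r * real i / real N)) = z ^ i" for i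
  proof -
    have "real i * (2 * pi * (of_int r / real N)) = 2 * pi * (of_int r * real i / real N)" by simp
    then show ?thesis by (simp only: z_def Complex.DeMoivre)
  qed
  ultimately show ?thesis by (simp add: geometric_sum)
qed

locale disjoint_interval_character = interval_character +
  assumes disj: "\<And>i j. i < N \<Longrightarrow> j < N \<Longrightarrow> i \<noteq> j \<Longrightarrow> unit_interval (c i) (l i) \<inter> unit_interval (c j) (l j) = {}"
begin

abbreviation M\<^sub>\<Omega> :: "(real \<times> int) measure" where
  "M\<^sub>\<Omega> \<equiv> restrict_space haar \<Omega>"

lemma sets_\<Omega>: "\<Omega> \<in> sets haar"
  unfolding \<Omega>_def by (intro sets.finite_UN finite_lessThan unit_interval_sets)

lemma indicator_\<Omega>: "indicator \<Omega> z = (\<Sum>i<N. indicator (unit_interval (c i) (l i)) z :: 'b :: semiring_1)"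
  unfolding \<Omega>_def using disj by (intro indicator_UN_disjoint) (auto simp: disjoint_family_on_def)

lemma nn_integral_\<Omega>:
  assumes [measurable]: "g \<in> borel_measurable haar"
  shows "(\<integral>\<^sup>+ z. g z \<partial>M\<^sub>\<Omega>) = (\<Sum>i<N. \<integral>\<^sup>+ u. g (c i + u, l i) \<partial>unit_measure)"
proof -
  have [measurable]: "unit_interval (c i) (l i) \<in> sets haar" for i by (rule unit_interval_sets)
  have "(\<integral>\<^sup>+ z. g z \<partial>M\<^sub>\<Omega>) = (\<integral>\<^sup>+ z. g z * indicator \<Omega> z \<partial>haar)"
    using sets_\<Omega> by (intro nn_integral_restrict_space) simp
  also have "\<dots> = (\<integral>\<^sup>+ z. (\<Sum>i<N. indicator (unit_interval (c i) (l i)) z * g z) \<partial>haar)"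
    by (simp only: indicator_\<Omega> sum_distrib_left mult.commute)
  also have "\<dots> = (\<Sum>i<N. \<integral>\<^sup>+ z. indicator (unit_interval (c i) (l i)) z * g z \<partial>haar)"
    by (intro nn_integral_sum) measurable
  finally show ?thesis by (simp add: nn_integral_unit_interval)
qed

lemma integral_\<Omega>:
  fixes g :: "real \<times> int \<Rightarrow> complex"
  assumes [measurable]: "g \<in> borel_measurable haar" and bnd: "\<And>z. cmod (g z) \<le> B"
  shows "(\<integral> z. g z \<partial>M\<^sub>\<Omega>) = (\<Sum>i<N. \<integral> u. g (c i + u, l i) \<partial>unit_measure)"
proof -
  have [measurable]: "unit_interval (c i) (l i) \<in> sets haar" for i by (rule unit_interval_sets)
  have int: "integrable haar (\<lambda>z. indicator (unit_interval (c i) (l i)) z *\<^sub>R g z)" for i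
    using bnd by (intro integrableI_bounded_set_indicator[where B = B]) (auto simp: emeasure_unit_interval)
  have "(\<integral> z. g z \<partial>M\<^sub>\<Omega>) = (\<integral> z. indicator \<Omega> z *\<^sub>R g z \<partial>haar)"
    using sets_\<Omega> by (intro integral_restrict_space) simp
  also have "\<dots> = (\<integral> z. (\<Sum>i<N. indicator (unit_interval (c i) (l i)) z *\<^sub>R g z) \<partial>haar)"
    by (simp only: indicator_\<Omega> scaleR_sum_left)
  also have "\<dots> = (\<Sum>i<N. \<integral> z. indicator (unit_interval (c i) (l i)) z *\<^sub>R g z \<partial>haar)"
    by (intro Bochner_Integration.integral_sum int)
  finally show ?thesis by (simp only: integral_unit_interval[OF assms(1)])
qed

text \<open>
  The term \<open>- \<lambda> \<xi>\<close> in the second coordinate undoes the shear \<open>c i = d i + l i * \<xi>\<close>.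
\<close>

definition freq :: "int \<times> nat \<Rightarrow> real \<times> circle" where
  "freq = (\<lambda>(k, m). (of_int k + real m * \<alpha>, abs_circle (real m * \<beta> - (of_int k + real m * \<alpha>) * \<xi>)))"

definition \<Sigma> :: "(real \<times> circle) set" where
  "\<Sigma> = freq ` (UNIV \<times> {..<N})"

definition E :: "real \<times> circle \<Rightarrow> real \<times> int \<Rightarrow> complex" where
  "E = (\<lambda>(r, \<eta>). character r \<eta>)"

lemma E_abs: "E (r, abs_circle y) (x, j) = cis (2 * pi * (r * x + y * of_int j))"
  by (simp add: E_def character.abs_eq)

lemma E_form: "\<exists>r y. E s = (\<lambda>z. cis (2 * pi * (r * fst z + y * of_int (snd z))))"
proof (cases s)
  case (Pair r \<eta>)
  moreover have "\<exists>y. \<eta> = abs_circle y" by (induction \<eta> rule: circle.abs_induct) blast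
  then obtain y where "\<eta> = abs_circle y" by blast
  ultimately have "E s z = cis (2 * pi * (r * fst z + y * of_int (snd z)))" for z
    using E_abs[of r y "fst z" "snd z"] by simp
  then show ?thesis by blast
qed

lemma E_measurable [measurable]: "E s \<in> borel_measurable haar"
proof -
  obtain r y where s: "E s = (\<lambda>z. cis (2 * pi * (r * fst z + y * of_int (snd z))))"
    using E_form by blast
  show ?thesis unfolding s cis_conv_exp by measurable
qed

lemma cmod_E: "cmod (E s z) = 1"
  using E_form[of s] by auto

text \<open>The shear cancels, and \<open>char_value\<close> replaces
  \<open>\<alpha> * d i + \<beta> * l i\<close> by \<open>i / N\<close> up to an integer, which
  remains an integer after multiplication by \<open>m\<close>. What is left separates into factors
  in \<open>u\<close> and factors in \<open>i\<close>.\<close>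

lemma E_freq:
  assumes "i < N"
  shows "E (freq (k, m)) (c i + u, l i) = cis (2 * pi * (real m * \<alpha> * u)) * trig k u
    * cis (2 * pi * (of_int k * d i)) * cis (2 * pi * (real m * real i / real N))"
proof -
  obtain n :: int where n: "\<alpha> * d i + \<beta> * of_int (l i) - real i / real N = of_int n"
    using char_value[OF assms] by (auto elim: Ints_cases)
  have "(of_int k + real m * \<alpha>) * (c i + u) + (real m * \<beta> - (of_int k + real m * \<alpha>) * \<xi>) * of_int (l i)
      = (of_int k + real m * \<alpha>) * u + of_int k * d i + real m * (\<alpha> * d i + \<beta> * of_int (l i))"
    using c_eq[OF assms] by (simp add: algebra_simps)
  also have "\<dots> = real m * \<alpha> * u + of_int k * u + of_int k * d i + real m * real i / real N + of_int (int m * n)"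
    using n by (simp add: algebra_simps diff_eq_eq)
  finally have "E (freq (k, m)) (c i + u, l i)
      = cis (2 * pi * (real m * \<alpha> * u + of_int k * u + of_int k * d i + real m * real i / real N) + 2 * pi * of_int (int m * n))"
    by (simp only: freq_def E_abs prod.case distrib_left[of "2 * pi"])
  also have "\<dots> = cis (2 * pi * (real m * \<alpha> * u + of_int k * u + of_int k * d i + real m * real i / real N)) * 1"
    by (simp only: cis_mult[symmetric] cis_multiple_2pi Ints_of_int)
  finally show ?thesis by (simp only: trig_def cis_mult distrib_left mult_1_right)
qed

lemma E_orthogonal:
  assumes "m < N" "m' < N" "(k, m) \<noteq> (k', m')"
  shows "(\<integral> z. E (freq (k, m)) z * cnj (E (freq (k', m')) z) \<partial>M\<^sub>\<Omega>) = 0"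
proof -
  define r where "r = int m - int m'"
  define t where "t = of_int (k - k') + of_int r * \<alpha>"
  have prod: "E (freq (k, m)) (c i + u, l i) * cnj (E (freq (k', m')) (c i + u, l i))
      = cis (2 * pi * (t * u)) * (cis (2 * pi * (of_int (k - k') * d i)) * cis (2 * pi * (of_int r * real i / real N)))"
    if "i < N" for i u
    by (simp add: E_freq[OF that] trig_def cis_cnj cis_mult t_def r_def)
       (simp add: algebra_simps diff_divide_distrib)
  have "(\<integral> z. E (freq (k, m)) z * cnj (E (freq (k', m')) z) \<partial>M\<^sub>\<Omega>)
      = (\<Sum>i<N. \<integral> u. E (freq (k, m)) (c i + u, l i) * cnj (E (freq (k', m')) (c i + u, l i)) \<partial>unit_measure)"
  proof (rule integral_\<Omega>[where B = 1])
    show "(\<lambda>z. E (freq (k, m)) z * cnj (E (freq (k', m')) z)) \<in> borel_measurable haar"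
      by (intro borel_measurable_times E_measurable
          measurable_compose[OF E_measurable borel_measurable_continuous_onI] continuous_intros)
  qed (simp add: norm_mult cmod_E)
  also have "\<dots> = (\<integral> u. cis (2 * pi * (t * u)) \<partial>unit_measure)
      * (\<Sum>i<N. cis (2 * pi * (of_int (k - k') * d i)) * cis (2 * pi * (of_int r * real i / real N)))"
    by (simp add: prod sum_distrib_left)
  also have "\<dots> = 0"
  \<comment> \<open>The inner product is an integral over \<open>u\<close> times a sum over
    \<open>i\<close>. In the first case the phases from \<open>d i\<close> are trivial and the sum
    runs over a nontrivial root of unity; otherwise \<open>r * \<alpha> = 0\<close>, so
    \<open>t\<close> is the nonzero integer \<open>k - k'\<close> and the integral vanishes.\<close>
  proof (cases "k = k' \<or> (\<forall>i<N. d i \<in> \<int>) \<and> m \<noteq> m'")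
    case True
    then have "m \<noteq> m'" using assms(3) by auto
    then have "0 < \<bar>r\<bar>" "\<bar>r\<bar> < int N" using assms by (auto simp: r_def)
    moreover have "cis (2 * pi * (of_int (k - k') * d i)) = 1" if "i < N" for i
      using True that by (intro cis_multiple_2pi) auto
    then have "(\<Sum>i<N. cis (2 * pi * (of_int (k - k') * d i)) * cis (2 * pi * (of_int r * real i / real N)))
        = (\<Sum>i<N. cis (2 * pi * (of_int r * real i / real N)))"
      by (intro sum.cong) simp_all
    ultimately show ?thesis by (simp only: sum_cis_root_of_unity mult_zero_right)
  next
    case False
    then have "of_int r * \<alpha> = 0" using d_Ints by (auto simp: r_def)
    then have "t \<noteq> 0" "t \<in> \<int>" using False by (auto simp: t_def)
    then show ?thesis by (simp add: integral_unit_measure_cis)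
  qed
  finally show ?thesis .
qed

lemma lin_comb_E_measurable: "w \<in> lin_comb \<Sigma> E \<Longrightarrow> w \<in> borel_measurable haar"
  by (rule lin_comb_measurable) measurable

lemma countable_\<Sigma>: "countable \<Sigma>"
  unfolding \<Sigma>_def by (intro countable_image countable_SIGMA) auto

end

lemma cmod_sum_square_le:
  "(cmod (\<Sum>i<N. f i))\<^sup>2 \<le> real N * (\<Sum>i<N. (cmod (f i))\<^sup>2)"
proof -
  have "(cmod (\<Sum>i<N. f i))\<^sup>2 \<le> (\<Sum>i<N. cmod (f i))\<^sup>2"
    by (intro power_mono norm_sum) simp
  also have "\<dots> \<le> (\<Sum>i<N. 1\<^sup>2) * (\<Sum>i<N. (cmod (f i))\<^sup>2)"
    using Cauchy_Schwarz_ineq_sum[of "\<lambda>_. 1" "\<lambda>i. cmod (f i)" "{..<N}"] by simp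
  finally show ?thesis by simp
qed

context disjoint_interval_character
begin

text \<open>
  The unitary \<open>B\<close> covers two situations: the identity matrix when \<open>\<alpha> = 0\<close>, and the
  discrete Fourier matrix twisted by \<open>cis (2 * pi * m * \<alpha> * u)\<close> when the \<open>d i\<close> are integers.
\<close>

lemma approx_from_pieces:
  fixes f :: "real \<times> int \<Rightarrow> complex" and B :: "nat \<Rightarrow> nat \<Rightarrow> real \<Rightarrow> complex"
  assumes [measurable]: "f \<in> borel_measurable haar"
    and G: "\<And>m. m < N \<Longrightarrow> G m \<in> borel_measurable borel"
      "\<And>m. m < N \<Longrightarrow> (\<integral>\<^sup>+ u. ennreal ((cmod (G m u))\<^sup>2) \<partial>unit_measure) < \<infinity>"
    and B: "\<And>i m u. i < N \<Longrightarrow> m < N \<Longrightarrow> cmod (B i m u) \<le> 1"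
    and f: "\<And>i u. i < N \<Longrightarrow> f (c i + u, l i) = (\<Sum>m<N. B i m u * G m u)"
    and gen: "\<And>m k. m < N \<Longrightarrow> \<exists>w\<in>lin_comb \<Sigma> E. \<forall>i<N. \<forall>u. w (c i + u, l i) = B i m u * trig k u"
  shows "L2_approx M\<^sub>\<Omega> (lin_comb \<Sigma> E) f"
  unfolding L2_approx_def
proof (intro allI impI)
  fix \<epsilon> :: real assume "\<epsilon> > 0"
  \<comment> \<open>The squared error picks up one factor \<open>N\<close> from the number of
    intervals, one from Cauchy-Schwarz, and one from the sum over \<open>m\<close>; the total is at
    most \<open>\<epsilon> / 2\<close>.\<close>
  define \<delta> where "\<delta> = \<epsilon> / (2 * real N ^ 3)"
  have "\<delta> > 0" using \<open>\<epsilon> > 0\<close> N_pos by (simp add: \<delta>_def)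
  then have "\<forall>m\<in>{..<N}. \<exists>v\<in>trig_polys. (\<integral>\<^sup>+ u. ennreal ((cmod (G m u - v u))\<^sup>2) \<partial>unit_measure) < ennreal \<delta>"
    using trig_polys_dense[OF G] by (auto simp: L2_approx_def)
  then obtain v where v: "\<And>m. m < N \<Longrightarrow> v m \<in> trig_polys"
    "\<And>m. m < N \<Longrightarrow> (\<integral>\<^sup>+ u. ennreal ((cmod (G m u - v m u))\<^sup>2) \<partial>unit_measure) < ennreal \<delta>"
    by (metis lessThan_iff)
  have v_meas: "v m \<in> borel_measurable borel" if "m < N" for m
    using v(1)[OF that] by (rule lin_comb_measurable) measurable
  have "\<exists>w\<in>lin_comb \<Sigma> E. \<forall>i<N. \<forall>u. w (c i + u, l i) = B i m u * v m u" if m: "m < N" for m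
  proof -
    obtain S a where S: "v m = (\<lambda>u. \<Sum>k\<in>S. a k * trig k u)"
      using v(1)[OF m] by (auto simp: lin_comb_def)
    obtain w where w: "\<And>k. w k \<in> lin_comb \<Sigma> E" "\<And>k i u. i < N \<Longrightarrow> w k (c i + u, l i) = B i m u * trig k u"
      using gen[OF m] by metis
    show ?thesis
    proof (intro bexI[of _ "\<lambda>z. \<Sum>k\<in>S. a k * w k z"] allI impI)
      show "(\<lambda>z. \<Sum>k\<in>S. a k * w k z) \<in> lin_comb \<Sigma> E" by (intro lin_comb_sum lin_comb_scale w)
    qed (simp add: S w(2) sum_distrib_left mult_ac)
  qed
  then obtain w where w: "\<And>m. m < N \<Longrightarrow> w m \<in> lin_comb \<Sigma> E"
    "\<And>m i u. m < N \<Longrightarrow> i < N \<Longrightarrow> w m (c i + u, l i) = B i m u * v m u"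
    by metis
  define W where "W z = (\<Sum>m<N. w m z)" for z
  have W: "W \<in> lin_comb \<Sigma> E" unfolding W_def[abs_def] by (intro lin_comb_sum w) simp
  then have [measurable]: "W \<in> borel_measurable haar" by (rule lin_comb_E_measurable)
  have "(\<integral>\<^sup>+ z. ennreal ((cmod (f z - W z))\<^sup>2) \<partial>M\<^sub>\<Omega>)
      = (\<Sum>i<N. \<integral>\<^sup>+ u. ennreal ((cmod (f (c i + u, l i) - W (c i + u, l i)))\<^sup>2) \<partial>unit_measure)"
    by (rule nn_integral_\<Omega>) measurable
  also have "\<dots> \<le> (\<Sum>i<N. ennreal (real N * (\<Sum>m<N. \<delta>)))"
  proof (intro sum_mono)
    fix i assume "i \<in> {..<N}"
    then have i: "i < N" by simp
    have "(\<integral>\<^sup>+ u. ennreal ((cmod (f (c i + u, l i) - W (c i + u, l i)))\<^sup>2) \<partial>unit_measure)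
        \<le> (\<integral>\<^sup>+ u. ennreal (real N) * (\<Sum>m<N. ennreal ((cmod (G m u - v m u))\<^sup>2)) \<partial>unit_measure)"
    proof (intro nn_integral_mono)
      fix u
      have "f (c i + u, l i) - W (c i + u, l i) = (\<Sum>m<N. B i m u * (G m u - v m u))"
        by (simp add: f[OF i] W_def w(2)[OF _ i] right_diff_distrib sum_subtractf)
      then have "(cmod (f (c i + u, l i) - W (c i + u, l i)))\<^sup>2 \<le> real N * (\<Sum>m<N. (cmod (B i m u * (G m u - v m u)))\<^sup>2)"
        by (simp only: cmod_sum_square_le)
      also have "\<dots> \<le> real N * (\<Sum>m<N. (cmod (G m u - v m u))\<^sup>2)"
        using B[OF i] by (intro mult_left_mono sum_mono power_mono) (auto simp: norm_mult mult_left_le_one_le)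
      finally have "ennreal ((cmod (f (c i + u, l i) - W (c i + u, l i)))\<^sup>2)
          \<le> ennreal (real N * (\<Sum>m<N. (cmod (G m u - v m u))\<^sup>2))" by (rule ennreal_leI)
      also have "\<dots> = ennreal (real N) * (\<Sum>m<N. ennreal ((cmod (G m u - v m u))\<^sup>2))"
        by (simp add: ennreal_mult sum_nonneg sum_ennreal)
      finally show "ennreal ((cmod (f (c i + u, l i) - W (c i + u, l i)))\<^sup>2)
          \<le> ennreal (real N) * (\<Sum>m<N. ennreal ((cmod (G m u - v m u))\<^sup>2))" .
    qed
    also have "\<dots> = ennreal (real N) * (\<Sum>m<N. \<integral>\<^sup>+ u. ennreal ((cmod (G m u - v m u))\<^sup>2) \<partial>unit_measure)"
    proof -
      have meas: "(\<lambda>u. ennreal ((cmod (G m u - v m u))\<^sup>2)) \<in> borel_measurable unit_measure"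
        if "m \<in> {..<N}" for m
      proof -
        have [measurable]: "G m \<in> borel_measurable borel" "v m \<in> borel_measurable borel"
          using that G(1) v_meas by auto
        show ?thesis unfolding measurable_cong_sets[OF sets_unit_measure refl] by measurable
      qed
      have "(\<integral>\<^sup>+ u. ennreal (real N) * (\<Sum>m<N. ennreal ((cmod (G m u - v m u))\<^sup>2)) \<partial>unit_measure)
          = ennreal (real N) * (\<integral>\<^sup>+ u. (\<Sum>m<N. ennreal ((cmod (G m u - v m u))\<^sup>2)) \<partial>unit_measure)"
        by (intro nn_integral_cmult borel_measurable_sum meas)
      then show ?thesis by (simp only: nn_integral_sum[OF meas])
    qed
    also have "\<dots> \<le> ennreal (real N) * (\<Sum>m<N. ennreal \<delta>)"
      using v(2) by (intro mult_left_mono sum_mono) (auto intro: less_imp_le)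
    also have "\<dots> = ennreal (real N * (\<Sum>m<N. \<delta>))"
      using \<open>\<delta> > 0\<close> by (simp only: sum_ennreal less_imp_le ennreal_mult[symmetric] sum_nonneg of_nat_0_le_iff)
    finally show "(\<integral>\<^sup>+ u. ennreal ((cmod (f (c i + u, l i) - W (c i + u, l i)))\<^sup>2) \<partial>unit_measure)
        \<le> ennreal (real N * (\<Sum>m<N. \<delta>))" .
  qed
  also have "\<dots> = ennreal (real N ^ 3 * \<delta>)"
    using \<open>\<delta> > 0\<close> by (simp add: power3_eq_cube ennreal_of_nat_eq_real_of_nat mult_ac flip: ennreal_mult)
  also have "\<dots> = ennreal (\<epsilon> / 2)" using N_pos by (simp add: \<delta>_def)
  also have "\<dots> < ennreal \<epsilon>" using \<open>\<epsilon> > 0\<close> by (intro ennreal_lessI) auto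
  finally show "\<exists>v\<in>lin_comb \<Sigma> E. (\<integral>\<^sup>+ z. ennreal ((cmod (f z - v z))\<^sup>2) \<partial>M\<^sub>\<Omega>) < ennreal \<epsilon>"
    using W by blast
qed

section \<open>Completeness by discrete Fourier inversion across the intervals\<close>

definition unity_root :: "int \<Rightarrow> nat \<Rightarrow> complex" where
  "unity_root m i = cis (2 * pi * (of_int m * real i / real N))"

lemma cmod_unity_root: "cmod (unity_root m i) = 1" by (simp add: unity_root_def)

lemma unity_root_mult: "unity_root m i * unity_root m' i = unity_root (m + m') i"
  by (simp add: unity_root_def cis_mult algebra_simps add_divide_distrib)

lemma unity_root_swap: "unity_root (int m) i = unity_root (int i) m"
  by (simp add: unity_root_def mult_ac)

lemma unity_root_swap_neg: "unity_root (- int m) i = unity_root (- int i) m"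
  by (simp add: unity_root_def mult_ac)

lemma sum_unity_root:
  assumes "i < N" "j < N"
  shows "(\<Sum>m<N. unity_root (int i - int j) m) = (if i = j then of_nat N else 0)"
  using sum_cis_root_of_unity[of "int i - int j" N] assms by (auto simp: unity_root_def)

lemma E_freq_in_lin_comb: "m < N \<Longrightarrow> E (freq (k, m)) \<in> lin_comb \<Sigma> E"
  unfolding \<Sigma>_def by (intro lin_comb_base imageI) auto

lemma approx_all_measurable:
  assumes [measurable]: "f \<in> borel_measurable haar"
    and f: "(\<integral>\<^sup>+ z. ennreal ((cmod (f z))\<^sup>2) \<partial>M\<^sub>\<Omega>) < \<infinity>"
  shows "L2_approx M\<^sub>\<Omega> (lin_comb \<Sigma> E) f"
proof -
  define F where "F i u = f (c i + u, l i)" for i u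
  have F_meas: "F i \<in> borel_measurable borel" for i
    unfolding F_def[abs_def] by measurable
  have F_fin: "(\<integral>\<^sup>+ u. ennreal ((cmod (F i u))\<^sup>2) \<partial>unit_measure) < \<infinity>" if "i < N" for i
  proof -
    have "(\<integral>\<^sup>+ u. ennreal ((cmod (F i u))\<^sup>2) \<partial>unit_measure)
        \<le> (\<Sum>i<N. \<integral>\<^sup>+ u. ennreal ((cmod (F i u))\<^sup>2) \<partial>unit_measure)"
      using that by (intro member_le_sum) auto
    also have "\<dots> = (\<integral>\<^sup>+ z. ennreal ((cmod (f z))\<^sup>2) \<partial>M\<^sub>\<Omega>)"
      unfolding F_def by (intro nn_integral_\<Omega>[symmetric]) measurable
    finally show ?thesis using f by (rule le_less_trans)
  qed
  show ?thesis
  proof (cases "\<alpha> = 0")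
    case True
    show ?thesis
    proof (rule approx_from_pieces[where G = F and B = "\<lambda>i m u. if i = m then 1 else 0"])
      show "f (c i + u, l i) = (\<Sum>m<N. (if i = m then 1 else 0) * F m u)" if "i < N" for i u
        using that by (simp add: F_def if_distrib[of "\<lambda>x. x * _"] cong: if_cong)
      show "\<exists>w\<in>lin_comb \<Sigma> E. \<forall>i<N. \<forall>u. w (c i + u, l i) = (if i = m then 1 else 0) * trig k u"
        if m: "m < N" for m k
      \<comment> \<open>For fixed \<open>k\<close>, an inverse discrete Fourier transform in
        \<open>j\<close> isolates interval \<open>m\<close>; the prefactor removes the number
        \<open>N\<close> and the phase \<open>cis (2 * pi * (of_int k * d m))\<close> of that
        interval.\<close>
      proof (intro bexI[of _ "\<lambda>z. cis (- (2 * pi * (of_int k * d m))) / of_nat N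
            * (\<Sum>j<N. unity_root (- int m) j * E (freq (k, j)) z)"] allI impI)
        fix i u assume i: "i < N"
        have "(\<Sum>j<N. unity_root (- int m) j * E (freq (k, j)) (c i + u, l i))
            = (\<Sum>j<N. trig k u * cis (2 * pi * (of_int k * d i)) * unity_root (int i - int m) j)"
        proof (intro sum.cong refl)
          fix j
          have "E (freq (k, j)) (c i + u, l i) = trig k u * cis (2 * pi * (of_int k * d i)) * unity_root (int i) j"
            using E_freq[OF i, of k j u] True by (simp add: unity_root_def mult_ac)
          then show "unity_root (- int m) j * E (freq (k, j)) (c i + u, l i)
              = trig k u * cis (2 * pi * (of_int k * d i)) * unity_root (int i - int m) j"
            by (simp add: unity_root_mult[symmetric] diff_conv_add_uminus del: add_uminus_conv_diff)
        qed
        also have "\<dots> = trig k u * cis (2 * pi * (of_int k * d i)) * (if i = m then of_nat N else 0)"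
          by (simp add: sum_unity_root[OF i m] flip: sum_distrib_left)
        finally show "cis (- (2 * pi * (of_int k * d m))) / of_nat N
            * (\<Sum>j<N. unity_root (- int m) j * E (freq (k, j)) (c i + u, l i)) = (if i = m then 1 else 0) * trig k u"
          using N_pos cis_mult[of "2 * pi * (of_int k * d m)" "- (2 * pi * (of_int k * d m))"]
          by (auto simp: field_simps)
      next
        show "(\<lambda>z. cis (- (2 * pi * (of_int k * d m))) / of_nat N
            * (\<Sum>j<N. unity_root (- int m) j * E (freq (k, j)) z)) \<in> lin_comb \<Sigma> E"
          by (intro lin_comb_scale lin_comb_sum E_freq_in_lin_comb) simp
      qed
    qed (use F_meas F_fin in auto)
  next
    case False
    define \<rho> where "\<rho> m u = cis (2 * pi * (real m * \<alpha> * u))" for m u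
    have \<rho>_meas [measurable]: "(\<lambda>u. cnj (\<rho> m u)) \<in> borel_measurable borel" for m
      unfolding \<rho>_def cis_cnj unfolding cis_conv_exp by measurable
    \<comment> \<open>Here the \<open>d i\<close> are integers, so a spectral function is
      \<open>\<rho> m u * unity_root m i * trig k u\<close>. \<open>G\<close> is the inverse
      transform of the pieces of \<open>f\<close> with the twist undone, so that synthesis with
      these factors returns \<open>f\<close>.\<close>
    define G where "G m u = cnj (\<rho> m u) / of_nat N * (\<Sum>i<N. unity_root (- int m) i * F i u)" for m u
    have G_meas: "G m \<in> borel_measurable borel" for m
      unfolding G_def[abs_def] using F_meas by measurable
    show ?thesis
    proof (rule approx_from_pieces[where G = G and B = "\<lambda>i m u. \<rho> m u * unity_root (int m) i"])
      show "(\<integral>\<^sup>+ u. ennreal ((cmod (G m u))\<^sup>2) \<partial>unit_measure) < \<infinity>" if "m < N" for m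
      proof -
        have "(\<integral>\<^sup>+ u. ennreal ((cmod (G m u))\<^sup>2) \<partial>unit_measure)
            \<le> (\<integral>\<^sup>+ u. (\<Sum>i<N. ennreal ((cmod (F i u))\<^sup>2)) \<partial>unit_measure)"
        proof (intro nn_integral_mono)
          fix u
          have "(cmod (G m u))\<^sup>2 = (cmod (\<Sum>i<N. unity_root (- int m) i * F i u))\<^sup>2 / (real N)\<^sup>2"
            by (simp add: G_def norm_mult norm_divide \<rho>_def power_divide)
          also have "\<dots> \<le> (real N * (\<Sum>i<N. (cmod (F i u))\<^sup>2)) / (real N)\<^sup>2"
            using cmod_sum_square_le[of "\<lambda>i. unity_root (- int m) i * F i u" N]
            by (intro divide_right_mono) (simp_all add: norm_mult cmod_unity_root)
          also have "\<dots> = (\<Sum>i<N. (cmod (F i u))\<^sup>2) / real N"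
            using N_pos by (simp add: power2_eq_square)
          also have "\<dots> \<le> (\<Sum>i<N. (cmod (F i u))\<^sup>2)"
            using N_pos frac_le[of "\<Sum>i<N. (cmod (F i u))\<^sup>2" "\<Sum>i<N. (cmod (F i u))\<^sup>2" 1 "real N"]
            by (simp add: sum_nonneg)
          finally show "ennreal ((cmod (G m u))\<^sup>2) \<le> (\<Sum>i<N. ennreal ((cmod (F i u))\<^sup>2))"
            by (simp add: sum_ennreal ennreal_leI)
        qed
        also have "\<dots> = (\<Sum>i<N. \<integral>\<^sup>+ u. ennreal ((cmod (F i u))\<^sup>2) \<partial>unit_measure)"
          using F_meas by (intro nn_integral_sum) (simp add: measurable_cong_sets[OF sets_unit_measure refl])
        also have "\<dots> < \<infinity>" using F_fin by (simp add: less_top)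
        finally show ?thesis .
      qed
      show "f (c i + u, l i) = (\<Sum>m<N. \<rho> m u * unity_root (int m) i * G m u)" if i: "i < N" for i u
      proof -
        have "\<rho> m u * unity_root (int m) i * G m u = (\<Sum>j<N. unity_root (int i - int j) m * F j u) / of_nat N" for m
        proof -
          have "\<rho> m u * cnj (\<rho> m u) = 1" by (simp add: \<rho>_def cis_cnj cis_mult)
          moreover have "\<rho> m u * unity_root (int m) i * G m u
              = (\<rho> m u * cnj (\<rho> m u)) * (unity_root (int m) i * (\<Sum>j<N. unity_root (- int m) j * F j u) / of_nat N)"
            by (simp only: G_def times_divide_eq_left times_divide_eq_right mult_ac)
          ultimately have "\<rho> m u * unity_root (int m) i * G m u = unity_root (int m) i * (\<Sum>j<N. unity_root (- int m) j * F j u) / of_nat N"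
            by simp
          also have "\<dots> = (\<Sum>j<N. unity_root (int i - int j) m * F j u) / of_nat N"
            by (simp add: sum_distrib_left unity_root_swap[of m i] unity_root_swap_neg[of m] unity_root_mult mult.assoc[symmetric])
          finally show ?thesis .
        qed
        then have "(\<Sum>m<N. \<rho> m u * unity_root (int m) i * G m u)
            = (\<Sum>m<N. \<Sum>j<N. unity_root (int i - int j) m * F j u) / of_nat N"
          by (simp add: sum_divide_distrib)
        also have "(\<Sum>m<N. \<Sum>j<N. unity_root (int i - int j) m * F j u)
            = (\<Sum>j<N. \<Sum>m<N. unity_root (int i - int j) m * F j u)" by (rule sum.swap)
        also have "\<dots> = (\<Sum>j<N. (if i = j then of_nat N else 0) * F j u)"
          by (simp add: sum_unity_root[OF i] flip: sum_distrib_right)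
        also have "\<dots> = of_nat N * F i u"
          using i by (simp add: if_distrib[of "\<lambda>x. x * _"] cong: if_cong)
        finally show ?thesis using N_pos by (simp add: F_def)
      qed
      show "\<exists>w\<in>lin_comb \<Sigma> E. \<forall>i<N. \<forall>u. w (c i + u, l i) = \<rho> m u * unity_root (int m) i * trig k u"
        if "m < N" for m k
      proof (intro bexI[of _ "E (freq (k, m))"] allI impI E_freq_in_lin_comb that)
        fix i u assume i: "i < N"
        have "cis (2 * pi * (of_int k * d i)) = 1"
          using False d_Ints i by (intro cis_multiple_2pi) auto
        then show "E (freq (k, m)) (c i + u, l i) = \<rho> m u * unity_root (int m) i * trig k u"
          using E_freq[OF i, of k m u] by (simp add: \<rho>_def unity_root_def mult_ac)
      qed
    qed (use G_meas in \<open>auto simp: norm_mult cmod_unity_root \<rho>_def\<close>)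
  qed
qed

lemma sum_square_integral_less:
  assumes "L2_approx M\<^sub>\<Omega> (lin_comb \<Sigma> E) f" "f \<in> borel_measurable M\<^sub>\<Omega>" "\<epsilon> > 0"
  shows "\<exists>S a. finite S \<and> S \<subseteq> \<Sigma> \<and> sqrt (\<integral> z. (cmod (f z - (\<Sum>s\<in>S. a s * E s z)))\<^sup>2 \<partial>M\<^sub>\<Omega>) < \<epsilon>"
proof -
  obtain w where w: "w \<in> lin_comb \<Sigma> E" "(\<integral>\<^sup>+ z. ennreal ((cmod (f z - w z))\<^sup>2) \<partial>M\<^sub>\<Omega>) < ennreal (\<epsilon>\<^sup>2)"
    using assms(1,3) unfolding L2_approx_def by (meson zero_less_power)
  obtain S a where S: "finite S" "S \<subseteq> \<Sigma>" "w = (\<lambda>z. \<Sum>s\<in>S. a s * E s z)"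
    using w(1) by (auto simp: lin_comb_def)
  have [measurable]: "w \<in> borel_measurable M\<^sub>\<Omega>"
    using w(1) by (intro measurable_restrict_space1 lin_comb_E_measurable)
  have [measurable]: "f \<in> borel_measurable M\<^sub>\<Omega>" by fact
  have "(\<integral> z. (cmod (f z - w z))\<^sup>2 \<partial>M\<^sub>\<Omega>) = enn2real (\<integral>\<^sup>+ z. ennreal ((cmod (f z - w z))\<^sup>2) \<partial>M\<^sub>\<Omega>)"
    by (intro integral_eq_nn_integral) auto
  also have "\<dots> < \<epsilon>\<^sup>2"
    using w(2)
    by (cases "\<integral>\<^sup>+ z. ennreal ((cmod (f z - w z))\<^sup>2) \<partial>M\<^sub>\<Omega>") (auto simp: ennreal_less_iff)
  finally have "sqrt (\<integral> z. (cmod (f z - w z))\<^sup>2 \<partial>M\<^sub>\<Omega>) < \<epsilon>"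
    using assms(3) real_sqrt_less_mono by fastforce
  then show ?thesis using S by blast
qed

lemma spectral_\<Omega>: "is_spectral \<Omega>"
proof -
  have emO: "emeasure M\<^sub>\<Omega> (space M\<^sub>\<Omega>) = emeasure haar \<Omega>"
    using sets_\<Omega> by (simp add: space_restrict_space emeasure_restrict_space)
  have adm: "0 < emeasure haar \<Omega>" "emeasure haar \<Omega> < \<infinity>"
    using admissible_\<Omega> by (auto simp: admissible_def)
  interpret finite_measure M\<^sub>\<Omega>
    using adm by (intro finite_measureI) (simp add: emO)
  have E_meas: "E s \<in> borel_measurable M\<^sub>\<Omega>" for s
    by (intro measurable_restrict_space1 E_measurable)
  have "orthogonal_basis_L2 M\<^sub>\<Omega> \<Sigma> E"
    unfolding orthogonal_basis_L2_def
  proof (intro conjI ballI allI impI)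
    fix s
    show "E s \<in> L2 M\<^sub>\<Omega>" using E_meas by (simp add: L2_def cmod_E)
    have "E s z \<noteq> 0" for z using cmod_E[of s z] by auto
    then have "(AE z in M\<^sub>\<Omega>. E s z = 0) \<longleftrightarrow> emeasure M\<^sub>\<Omega> (space M\<^sub>\<Omega>) = 0"
      by (simp add: eventually_False ae_filter_eq_bot_iff)
    then show "\<not> (AE z in M\<^sub>\<Omega>. E s z = 0)" using adm emO by simp
  next
    fix s t assume "s \<in> \<Sigma>" "t \<in> \<Sigma>" "s \<noteq> t"
    then show "(\<integral> z. E s z * cnj (E t z) \<partial>M\<^sub>\<Omega>) = 0"
      unfolding \<Sigma>_def by (auto intro!: E_orthogonal)
  next
    fix f \<epsilon> assume f: "f \<in> L2 M\<^sub>\<Omega>" and "(\<epsilon> :: real) > 0"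
    then have f_meas: "f \<in> borel_measurable M\<^sub>\<Omega>" and int: "integrable M\<^sub>\<Omega> (\<lambda>z. (cmod (f z))\<^sup>2)"
      by (auto simp: L2_def)
    \<comment> \<open>Extension by zero: \<open>f\<close> is measurable only on
      \<open>\<Omega>\<close>, whereas the approximation result takes functions measurable on the
      whole group.\<close>
    define g where "g z = indicator \<Omega> z *\<^sub>R f z" for z
    have g: "g \<in> borel_measurable haar"
      using f_meas sets_\<Omega> unfolding g_def[abs_def] by (simp add: borel_measurable_restrict_space_iff)
    have eq: "g z = f z" if "z \<in> space M\<^sub>\<Omega>" for z
      using that by (simp add: g_def space_restrict_space)
    have "(\<integral>\<^sup>+ z. ennreal ((cmod (g z))\<^sup>2) \<partial>M\<^sub>\<Omega>) = (\<integral>\<^sup>+ z. ennreal ((cmod (f z))\<^sup>2) \<partial>M\<^sub>\<Omega>)"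
      by (intro nn_integral_cong) (simp add: eq)
    also have "\<dots> < \<infinity>"
      using int by (simp add: integrable_iff_bounded)
    finally have "L2_approx M\<^sub>\<Omega> (lin_comb \<Sigma> E) g" by (rule approx_all_measurable[OF g])
    moreover have "(\<integral>\<^sup>+ z. ennreal ((cmod (g z - v z))\<^sup>2) \<partial>M\<^sub>\<Omega>) = (\<integral>\<^sup>+ z. ennreal ((cmod (f z - v z))\<^sup>2) \<partial>M\<^sub>\<Omega>)" for v
      by (intro nn_integral_cong) (simp add: eq)
    ultimately have "L2_approx M\<^sub>\<Omega> (lin_comb \<Sigma> E) f" by (simp add: L2_approx_def)
    then show "\<exists>S a. finite S \<and> S \<subseteq> \<Sigma> \<and> sqrt (\<integral> z. (cmod (f z - (\<Sum>s\<in>S. a s * E s z)))\<^sup>2 \<partial>M\<^sub>\<Omega>) < \<epsilon>"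
      using f_meas \<open>\<epsilon> > 0\<close> by (rule sum_square_integral_less)
  qed
  then show ?thesis
    unfolding is_spectral_def E_def using admissible_\<Omega> countable_\<Sigma> by blast
qed

end

section \<open>The three intervals\<close>

text \<open>The intervals are numbered 0, 1, 2 with target values 0, 1/3, 2/3. The first one has
  zero offset and level 0, so only the other two impose conditions.\<close>

lemma Omega_tile_spectralI:
  fixes a b d1 d2 \<xi> \<alpha> \<beta> :: real and l1 l2 :: int
  assumes disj: "unit_interval 0 0 \<inter> unit_interval a l1 = {}"
      "unit_interval 0 0 \<inter> unit_interval b l2 = {}" "unit_interval a l1 \<inter> unit_interval b l2 = {}"
    and ab: "a = d1 + of_int l1 * \<xi>" "b = d2 + of_int l2 * \<xi>"
    and d: "\<alpha> = 0 \<or> d1 \<in> \<int> \<and> d2 \<in> \<int>"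
    and char: "\<alpha> * d1 + \<beta> * of_int l1 - 1 / 3 \<in> \<int>" "\<alpha> * d2 + \<beta> * of_int l2 - 2 / 3 \<in> \<int>"
  shows "is_tile (Omega a l1 b l2) \<and> is_weak_tile (Omega a l1 b l2) \<and> is_spectral (Omega a l1 b l2)"
proof -
  define c :: "nat \<Rightarrow> real" where "c i = (if i = 0 then 0 else if i = 1 then a else b)" for i
  define d' :: "nat \<Rightarrow> real" where "d' i = (if i = 0 then 0 else if i = 1 then d1 else d2)" for i
  define l :: "nat \<Rightarrow> int" where "l i = (if i = 0 then 0 else if i = 1 then l1 else l2)" for i
  have less3: "i < 3 \<longleftrightarrow> i = 0 \<or> i = 1 \<or> i = 2" for i :: nat by auto
  interpret disjoint_interval_character 3 c d' l \<xi> \<alpha> \<beta>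
  proof
    show "c i = d' i + of_int (l i) * \<xi>" if "i < 3" for i
      using ab by (simp add: c_def d'_def l_def)
    show "\<alpha> = 0 \<or> (\<forall>i<3. d' i \<in> \<int>)" using d by (auto simp: d'_def)
    show "\<alpha> * d' i + \<beta> * of_int (l i) - real i / real 3 \<in> \<int>" if "i < 3" for i
      using that char unfolding less3 by (auto simp: d'_def l_def)
    show "unit_interval (c i) (l i) \<inter> unit_interval (c j) (l j) = {}" if "i < 3" "j < 3" "i \<noteq> j" for i j
      using that disj unfolding less3 by (auto simp: c_def l_def)
  qed simp
  have "\<Omega> = Omega a l1 b l2"
    unfolding \<Omega>_def Omega_def by (simp add: numeral_3_eq_3 lessThan_Suc c_def l_def Un_ac)
  then show ?thesis using tile_\<Omega> weak_tile_\<Omega> spectral_\<Omega> by simp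
qed

section \<open>Choice of the character in each case\<close>

lemma coprime_3_dvd_sum_character:
  fixes p q :: int
  assumes "coprime p q" "3 dvd p + q"
  obtains s :: real where "s * of_int p - 1 / 3 \<in> \<int>" "s * of_int q - 2 / 3 \<in> \<int>"
proof -
  have mod: "of_int x = 3 * of_int (x div 3) + real_of_int (x mod 3)" for x :: int
    by (metis mult_div_mod_eq of_int_add of_int_mult of_int_numeral)
  consider "p mod 3 = 1" "q mod 3 = 2" | "p mod 3 = 2" "q mod 3 = 1"
    using coprime_3_dvd_sum[OF assms] by blast
  then show thesis
  proof cases
    case 1
    have "of_int p = 3 * real_of_int (p div 3) + 1" "of_int q = 3 * real_of_int (q div 3) + 2"
      using mod[of p] mod[of q] 1 by simp_all
    then have "1 / 3 * of_int p - 1 / 3 = real_of_int (p div 3)" "1 / 3 * of_int q - 2 / 3 = real_of_int (q div 3)"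
      by linarith+
    then show thesis using that[of "1 / 3"] by (metis Ints_of_int)
  next
    case 2
    have "of_int p = 3 * real_of_int (p div 3) + 2" "of_int q = 3 * real_of_int (q div 3) + 1"
      using mod[of p] mod[of q] 2 by simp_all
    then have "- 1 / 3 * of_int p - 1 / 3 = real_of_int (- (p div 3) - 1)"
      "- 1 / 3 * of_int q - 2 / 3 = real_of_int (- (q div 3) - 1)"
      by linarith+
    then show thesis using that[of "- 1 / 3"] by (metis Ints_of_int)
  qed
qed

lemma Omega_tile_spectral_sheared:
  fixes a b \<xi> :: real and l1 l2 M N :: int
  assumes disj: "unit_interval 0 0 \<inter> unit_interval a l1 = {}"
      "unit_interval 0 0 \<inter> unit_interval b l2 = {}" "unit_interval a l1 \<inter> unit_interval b l2 = {}"
    and ab: "a = of_int M + of_int l1 * \<xi>" "b = of_int N + of_int l2 * \<xi>"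
    and det: "M * l2 - N * l1 \<noteq> 0"
  shows "is_tile (Omega a l1 b l2) \<and> is_weak_tile (Omega a l1 b l2) \<and> is_spectral (Omega a l1 b l2)"
proof -
  define D :: real where "D = of_int M * of_int l2 - of_int N * of_int l1"
  have "D = of_int (M * l2 - N * l1)" by (simp add: D_def)
  then have "D \<noteq> 0" using det by (simp only: of_int_eq_0_iff not_False_eq_True)
  \<comment> \<open>Cramer's rule for the system \<open>\<alpha> * M + \<beta> * l1 = 1 / 3\<close>,
    \<open>\<alpha> * N + \<beta> * l2 = 2 / 3\<close>, whose determinant is \<open>D\<close>. Since
    \<open>M\<close> and \<open>N\<close> are integers, a nonzero \<open>\<alpha>\<close> is
    allowed.\<close>
  define \<alpha> where "\<alpha> = (of_int l2 - 2 * of_int l1) / (3 * D)"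
  define \<beta> where "\<beta> = (2 * of_int M - of_int N) / (3 * D)"
  have "\<alpha> * of_int M + \<beta> * of_int l1 = D / (3 * D)"
    unfolding \<alpha>_def \<beta>_def D_def by (simp add: algebra_simps flip: add_divide_distrib)
  moreover have "\<alpha> * of_int N + \<beta> * of_int l2 = 2 * D / (3 * D)"
    unfolding \<alpha>_def \<beta>_def D_def by (simp add: algebra_simps flip: add_divide_distrib)
  ultimately have "\<alpha> * of_int M + \<beta> * of_int l1 = 1 / 3" "\<alpha> * of_int N + \<beta> * of_int l2 = 2 / 3"
    using \<open>D \<noteq> 0\<close> by (simp_all only:) simp_all
  then have "\<alpha> * of_int M + \<beta> * of_int l1 - 1 / 3 = 0" "\<alpha> * of_int N + \<beta> * of_int l2 - 2 / 3 = 0"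
    by (simp_all only: diff_self)
  then have "\<alpha> * of_int M + \<beta> * of_int l1 - 1 / 3 \<in> \<int>" "\<alpha> * of_int N + \<beta> * of_int l2 - 2 / 3 \<in> \<int>"
    by (simp_all only: Ints_0)
  then show ?thesis
    by (intro Omega_tile_spectralI[OF disj ab, of \<alpha> \<beta>]) simp_all
qed

text \<open>The character is taken to depend on the level alone (\<open>\<alpha> = 0\<close>, no
  shear), so \<open>a\<close> and \<open>b\<close> may be arbitrary reals; division by
  \<open>g\<close> reduces the levels to \<open>p\<close> and \<open>q\<close>.\<close>

lemma Omega_tile_spectral_levels:
  fixes a b :: real and g p q :: int
  assumes disj: "unit_interval 0 0 \<inter> unit_interval a (g * p) = {}"
      "unit_interval 0 0 \<inter> unit_interval b (g * q) = {}" "unit_interval a (g * p) \<inter> unit_interval b (g * q) = {}"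
    and g: "g \<noteq> 0" and pq: "coprime p q" "3 dvd p + q"
  shows "is_tile (Omega a (g * p) b (g * q)) \<and> is_weak_tile (Omega a (g * p) b (g * q))
    \<and> is_spectral (Omega a (g * p) b (g * q))"
proof -
  obtain s :: real where "s * of_int p - 1 / 3 \<in> \<int>" "s * of_int q - 2 / 3 \<in> \<int>"
    using coprime_3_dvd_sum_character[OF pq] .
  then show ?thesis
    using g by (intro Omega_tile_spectralI[OF disj, of a 0 b 0 "s / of_int g"]) simp_all
qed

text \<open>The mirror image of the level case: the offsets are now the integers being tiled, so the
  character depends on the horizontal coordinate alone.\<close>

lemma Omega_tile_spectral_same_level:
  fixes g p q :: int
  assumes disj: "unit_interval 0 0 \<inter> unit_interval (of_int (g * p)) 0 = {}"
      "unit_interval 0 0 \<inter> unit_interval (of_int (g * q)) 0 = {}"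
      "unit_interval (of_int (g * p)) 0 \<inter> unit_interval (of_int (g * q)) 0 = {}"
    and g: "g \<noteq> 0" and pq: "coprime p q" "3 dvd p + q"
  shows "is_tile (Omega (of_int (g * p)) 0 (of_int (g * q)) 0) \<and> is_weak_tile (Omega (of_int (g * p)) 0 (of_int (g * q)) 0)
    \<and> is_spectral (Omega (of_int (g * p)) 0 (of_int (g * q)) 0)"
proof -
  obtain s :: real where "s * of_int p - 1 / 3 \<in> \<int>" "s * of_int q - 2 / 3 \<in> \<int>"
    using coprime_3_dvd_sum_character[OF pq] .
  then show ?thesis
    using g by (intro Omega_tile_spectralI[OF disj, of "of_int (g * p)" 0 "of_int (g * q)" "s / of_int g" 0]) simp_all
qed

section \<open>Linear independence and the case analysis\<close>

lemma Q_independent_iff_det: "Q_independent (M, l1) (N, l2) \<longleftrightarrow> M * l2 - N * l1 \<noteq> 0"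
proof
  assume Q: "Q_independent (M, l1) (N, l2)"
  show "M * l2 - N * l1 \<noteq> 0"
  proof
    assume det: "M * l2 - N * l1 = 0"
    have imp: "p = 0 \<and> q = 0" if "p * of_int M + q * of_int N = 0" "p * of_int l1 + q * of_int l2 = 0" for p q :: rat
      using Q[unfolded Q_independent_def fst_conv snd_conv, THEN spec, THEN spec, THEN mp, OF conjI, OF that] .
    have "of_int l2 * of_int M + (- of_int l1) * of_int N = (of_int (M * l2 - N * l1) :: rat)"
      by (simp add: algebra_simps)
    then have "of_int l2 * of_int M + (- of_int l1) * of_int N = (0 :: rat)" by (simp only: det of_int_0)
    moreover have "of_int l2 * of_int l1 + (- of_int l1) * of_int l2 = (0 :: rat)" by simp
    ultimately have "l1 = 0" "l2 = 0" using imp[of "of_int l2" "- of_int l1"] by auto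
    have "of_int N * of_int M + (- of_int M) * of_int N = (0 :: rat)" by simp
    then have "M = 0" "N = 0" using imp[of "of_int N" "- of_int M"] \<open>l1 = 0\<close> \<open>l2 = 0\<close> by auto
    then show False using imp[of 1 0] \<open>l1 = 0\<close> by simp
  qed
next
  assume det: "M * l2 - N * l1 \<noteq> 0"
  define D :: rat where "D = of_int M * of_int l2 - of_int N * of_int l1"
  have "D = of_int (M * l2 - N * l1)" by (simp add: D_def)
  then have "D \<noteq> 0" using det by (simp only: of_int_eq_0_iff not_False_eq_True)
  show "Q_independent (M, l1) (N, l2)"
    unfolding Q_independent_def
  proof (intro allI impI)
    fix p q :: rat
    assume "p * of_int (fst (M, l1)) + q * of_int (fst (N, l2)) = 0 \<and> p * of_int (snd (M, l1)) + q * of_int (snd (N, l2)) = 0"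
    note this[unfolded fst_conv snd_conv]
    then have e: "p * of_int M + q * of_int N = 0" "p * of_int l1 + q * of_int l2 = 0" by (rule conjunct1, rule conjunct2)
    have "p * D = (p * of_int M + q * of_int N) * of_int l2 - (p * of_int l1 + q * of_int l2) * of_int N"
      "q * D = (p * of_int l1 + q * of_int l2) * of_int M - (p * of_int M + q * of_int N) * of_int l1"
      by (simp_all add: D_def algebra_simps)
    then have "p * D = 0" "q * D = 0" by (simp_all only: e mult_zero_left diff_self)
    then show "p = 0 \<and> q = 0" using \<open>D \<noteq> 0\<close> by simp
  qed
qed

lemma unit_intervals_disjoint_imp_neq: "unit_interval c l \<inter> unit_interval d l = {} \<Longrightarrow> c \<noteq> d"
  by (auto simp: unit_interval_def)

lemma int_gcd_decomposition:
  fixes m n :: int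
  assumes "m \<noteq> 0 \<or> n \<noteq> 0"
  obtains g p q where "g \<noteq> 0" "m = g * p" "n = g * q" "coprime p q"
proof -
  have "gcd m n \<noteq> 0" using assms by simp
  then obtain p q where "m = p * gcd m n" "n = q * gcd m n" "coprime p q"
    using gcd_coprime_exists by blast
  then show thesis using \<open>gcd m n \<noteq> 0\<close> by (intro that[of "gcd m n" p q]) (simp_all add: mult.commute)
qed

lemma cases_imp_tile_spectral:
  assumes disj: "unit_interval 0 0 \<inter> unit_interval a l1 = {}"
      "unit_interval 0 0 \<inter> unit_interval b l2 = {}" "unit_interval a l1 \<inter> unit_interval b l2 = {}"
    and cases: "same_level a l1 b l2 \<or> two_levels a l1 b l2 \<or> three_levels a l1 b l2"
  shows "is_tile (Omega a l1 b l2) \<and> is_weak_tile (Omega a l1 b l2) \<and> is_spectral (Omega a l1 b l2)"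
  using cases
proof (elim disjE)
  assume same: "same_level a l1 b l2"
  then have l: "l1 = 0" "l2 = 0" and tiles: "tiles_Ints {0, a, b}" by (auto simp: same_level_def)
  then have "a \<in> \<int>" "b \<in> \<int>" by (auto simp: tiles_Ints_def)
  then obtain A B where AB: "a = of_int A" "b = of_int B" by (auto elim!: Ints_cases)
  have "a \<noteq> 0" "b \<noteq> 0" "a \<noteq> b"
    using disj unit_intervals_disjoint_imp_neq unfolding l by blast+
  then have ne: "A \<noteq> 0" "B \<noteq> 0" "A \<noteq> B" using AB by auto
  then obtain g p q where gpq: "g \<noteq> 0" "A = g * p" "B = g * q" "coprime p q"
    using int_gcd_decomposition by blast
  have "3 dvd p + q" using tiles ne unfolding AB gpq by (rule tiles_Ints_tripleD)
  then show ?thesis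
    using disj unfolding l AB gpq(2,3) by (intro Omega_tile_spectral_same_level gpq) auto
next
  assume two: "two_levels a l1 b l2"
  then consider "0 \<noteq> l1" "l1 = l2" "a - b \<in> \<int> - {0}" | "l1 = 0" "0 \<noteq> l2" "a \<in> \<int> - {0}"
    | "l2 = 0" "0 \<noteq> l1" "b \<in> \<int> - {0}" by (auto simp: two_levels_def)
  then show ?thesis
  proof cases
    case 1
    then obtain n where "a - b = of_int n" "n \<noteq> 0" by (auto elim!: Ints_cases)
    then show ?thesis
      \<comment> \<open>In each of the three two-level cases, shearing moves an interval off level 0
        to offset 0 and makes the other offset an integer. Up to sign, the determinant is the
        product of the nonzero level and the nonzero integer \<open>n\<close>.\<close>
      using 1 by (intro Omega_tile_spectral_sheared[OF disj, of 0 "a / of_int l1" "- n"]) simp_all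
  next
    case 2
    then obtain n where "a = of_int n" "n \<noteq> 0" by (auto elim!: Ints_cases)
    then show ?thesis
      using 2 by (intro Omega_tile_spectral_sheared[OF disj, of n "b / of_int l2" 0]) simp_all
  next
    case 3
    then obtain n where "b = of_int n" "n \<noteq> 0" by (auto elim!: Ints_cases)
    then show ?thesis
      using 3 by (intro Omega_tile_spectral_sheared[OF disj, of 0 "a / of_int l1" n]) simp_all
  qed
next
  assume three: "three_levels a l1 b l2"
  then have ne: "l1 \<noteq> 0" "l2 \<noteq> 0" "l1 \<noteq> l2" by (auto simp: three_levels_def)
  from three consider "tiles_Ints {0, of_int l1, of_int l2}"
    | \<xi> M N where "a = of_int M + of_int l1 * \<xi>" "b = of_int N + of_int l2 * \<xi>" "Q_independent (M, l1) (N, l2)"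
    unfolding three_levels_def by blast
  then show ?thesis
  proof cases
    case 1
    obtain g p q where gpq: "g \<noteq> 0" "l1 = g * p" "l2 = g * q" "coprime p q"
      using int_gcd_decomposition ne by blast
    have "3 dvd p + q" using 1 ne unfolding gpq by (rule tiles_Ints_tripleD)
    then show ?thesis
      using disj unfolding gpq(2,3) by (intro Omega_tile_spectral_levels gpq) auto
  next
    case 2
    then show ?thesis unfolding Q_independent_iff_det by (intro Omega_tile_spectral_sheared[OF disj])
  qed
qed

text \<open>After extracting the greatest common divisor, everything is decided by whether 3 divides
  \<open>p + q\<close>. If not, the nonzero integer \<open>q * a - p * b\<close> specializes, up to
  sign, to \<open>a\<close>, \<open>b\<close> or \<open>a - b\<close> when two levels
  coincide.\<close>

lemma weak_tile_imp_cases: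
  assumes disj: "unit_interval 0 0 \<inter> unit_interval a l1 = {}"
      "unit_interval 0 0 \<inter> unit_interval b l2 = {}" "unit_interval a l1 \<inter> unit_interval b l2 = {}"
    and tile: "is_weak_tile (Omega a l1 b l2)"
  shows "same_level a l1 b l2 \<or> two_levels a l1 b l2 \<or> three_levels a l1 b l2"
proof (cases "l1 = 0 \<and> l2 = 0")
  case True
  then have l: "l1 = 0" "l2 = 0" by simp_all
  have "a \<in> \<int>" "b \<in> \<int>"
    using weak_tile_same_level_Ints[of a b] disj tile unfolding l by blast+
  then obtain A B where AB: "a = of_int A" "b = of_int B" by (auto elim!: Ints_cases)
  have "a \<noteq> 0" using disj(1) unit_intervals_disjoint_imp_neq unfolding l by blast
  then have "A \<noteq> 0" using AB by simp
  then obtain g p q where gpq: "g \<noteq> 0" "A = g * p" "B = g * q" "coprime p q"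
    using int_gcd_decomposition by blast
  have "3 dvd p + q"
  proof (rule ccontr)
    assume "\<not> 3 dvd p + q"
    \<comment> \<open>On a single level the offsets themselves are \<open>g * p\<close> and
      \<open>g * q\<close>, so this combination is 0.\<close>
    then have "of_int q * a + of_int (- p) * b \<in> \<int> - {0}"
      by (intro weak_tile_kernel[OF disj tile]) (simp_all add: l add.commute)
    then show False by (simp add: AB gpq mult_ac)
  qed
  then have "same_level a l1 b l2"
    using tiles_Ints_tripleI[OF gpq(1,4)] by (simp add: same_level_def l AB gpq)
  then show ?thesis by blast
next
  case False
  then obtain g p q where gpq: "g \<noteq> 0" "l1 = g * p" "l2 = g * q" "coprime p q"
    using int_gcd_decomposition by blast
  show ?thesis
  proof (cases "3 dvd p + q")
    case True
    then have "p \<noteq> 0" "q \<noteq> 0" "p \<noteq> q" using coprime_3_dvd_sum[OF gpq(4)] by auto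
    then have "three_levels a l1 b l2"
      using tiles_Ints_tripleI[OF gpq(1,4) True] gpq(1) by (simp add: three_levels_def gpq(2,3))
    then show ?thesis by blast
  next
    case not3: False
    then have "of_int q * a + of_int (- p) * b \<in> \<int> - {0}"
      by (intro weak_tile_kernel[OF disj tile]) (simp_all add: gpq(2,3) add.commute)
    then have D: "of_int q * a - of_int p * b \<in> \<int>" "of_int q * a - of_int p * b \<noteq> 0" by auto
    consider "p = 0" | "q = 0" | "p = q" | "p \<noteq> 0" "q \<noteq> 0" "p \<noteq> q" by blast
    then show ?thesis
    proof cases
      case 1
      then have "q = 1 \<or> q = - 1" using gpq(4) by auto
      then have "a \<in> \<int> - {0}" using D 1 by (auto simp: minus_in_Ints_iff)
      then have "two_levels a l1 b l2" using False 1 by (auto simp: two_levels_def gpq card_insert_if)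
      then show ?thesis by blast
    next
      case 2
      then have "p = 1 \<or> p = - 1" using gpq(4) by auto
      then have "b \<in> \<int> - {0}" using D 2 by (auto simp: minus_in_Ints_iff)
      then have "two_levels a l1 b l2" using False 2 by (auto simp: two_levels_def gpq card_insert_if)
      then show ?thesis by blast
    next
      case 3
      then have "q = 1 \<or> q = - 1" using gpq(4) by auto
      then have "a - b \<in> \<int>" "a - b \<noteq> 0"
        using D 3 minus_in_Ints_iff[of "a - b"] by auto
      then have "two_levels a l1 b l2" using False 3 by (auto simp: two_levels_def gpq card_insert_if)
      then show ?thesis by blast
    next
      case 4
      have ne: "g * p \<noteq> 0" "g * q \<noteq> 0" "g * p \<noteq> g * q" using 4 gpq(1) by auto
      have not_tiles: "\<not> tiles_Ints {0, of_int l1, of_int l2}"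
        using tiles_Ints_tripleD[OF _ ne] not3 unfolding gpq(2,3) by blast
      obtain D where D': "of_int q * a - of_int p * b = of_int D" using D(1) by (auto elim: Ints_cases)
      then have "D \<noteq> 0" using D(2) by auto
      obtain u v where uv: "u * p + v * q = 1" using gpq(4) bezout_int[of p q] by auto
      \<comment> \<open>Bezout's identity gives integers with \<open>q * M - p * N = D\<close>. Then
        \<open>a - M\<close> and \<open>b - N\<close> are in the ratio of \<open>p\<close> to
        \<open>q\<close>, hence of the levels, so one \<open>\<xi>\<close> serves both; the
        determinant becomes \<open>g * D\<close>.\<close>
      define M where "M = D * v"
      define N where "N = - (D * u)"
      have MN: "q * M - p * N = D"
      proof -
        have "q * M - p * N = D * (u * p + v * q)" by (simp add: M_def N_def algebra_simps)
        then show ?thesis by (simp add: uv)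
      qed
      define \<xi> where "\<xi> = (a - of_int M) / of_int l1"
      have a: "a = of_int M + of_int l1 * \<xi>" using ne by (simp add: \<xi>_def gpq(2))
      have "of_int p * (b - of_int N) = of_int q * (a - of_int M)"
        using D' unfolding MN[symmetric] by (simp add: algebra_simps)
      then have "b - of_int N = of_int q * (a - of_int M) / of_int p"
        using 4 by (simp add: field_simps)
      then have b: "b = of_int N + of_int l2 * \<xi>"
        using gpq(1) by (simp add: \<xi>_def gpq(2,3) diff_eq_eq add.commute)
      have "M * l2 - N * l1 = g * D" unfolding MN[symmetric] gpq(2,3) by (simp add: algebra_simps)
      then have "Q_independent (M, l1) (N, l2)"
        using \<open>D \<noteq> 0\<close> gpq(1) by (simp add: Q_independent_iff_det)
      then have "three_levels a l1 b l2"
        using ne not_tiles a b unfolding three_levels_def gpq(2,3) by (metis (no_types))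
      then show ?thesis by blast
    qed
  qed
qed

text \<open>The three cases are told apart by the number of distinct levels, so they exclude each
  other and "exactly one" amounts to "at least one".\<close>

theorem theorem7p1:
  fixes a b :: real and l1 l2 :: int
  assumes "non_overlapping (unit_interval 0 0) (unit_interval a l1)"
    and "non_overlapping (unit_interval 0 0) (unit_interval b l2)"
    and "non_overlapping (unit_interval a l1) (unit_interval b l2)"
  shows "(is_weak_tile (Omega a l1 b l2) \<longleftrightarrow>
            (same_level a l1 b l2 \<and> \<not> two_levels a l1 b l2 \<and> \<not> three_levels a l1 b l2) \<or>
            (\<not> same_level a l1 b l2 \<and> two_levels a l1 b l2 \<and> \<not> three_levels a l1 b l2) \<or>
            (\<not> same_level a l1 b l2 \<and> \<not> two_levels a l1 b l2 \<and> three_levels a l1 b l2)) \<and>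
         (same_level a l1 b l2 \<or> two_levels a l1 b l2 \<or> three_levels a l1 b l2 \<longrightarrow>
            is_tile (Omega a l1 b l2) \<and> is_spectral (Omega a l1 b l2))"
proof -
  note disj = assms[THEN non_overlapping_unit_intervalD]
  have "\<not> (same_level a l1 b l2 \<and> two_levels a l1 b l2)" "\<not> (same_level a l1 b l2 \<and> three_levels a l1 b l2)"
    "\<not> (two_levels a l1 b l2 \<and> three_levels a l1 b l2)"
    by (auto simp: same_level_def two_levels_def three_levels_def)
  then show ?thesis
    using cases_imp_tile_spectral[OF disj] weak_tile_imp_cases[OF disj] by blast
qed

end
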